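(* Let $m\ge3$ be an odd integer and $n$ an integer with $2m<n$. Let $\lambda$ and $a$ be constants with $$\frac{2m+n-2}{n-2}<\lambda<\frac{n}{n-2m},\qquad a=\frac{4m(m-1)}{n-\lambda(n-2m)}.$$ Let $\varphi:(0,1)\to(0,1)$ be continuous with $\lim_{r\to0^+}\varphi(r)=0$. Then there exists a $C^\infty$ positive solution $u$ of $$0\le-\Delta^m u\le u^\lambda\quad\text{in }\mathbb{R}^n\setminus\{0\}$$ such that $u(x)\neq O(\varphi(|x|)|x|^{-a})$ as $x\to0$.
   Context: $\Delta^m$ is the $m$-fold iterated Laplacian. For positive functions, "$u(x)\neq O(h(x))$ as $x\to0$" means $\limsup_{x\to0} u(x)/h(x)=\infty$. *)

theory Defs
  imports "HOL-Analysis.Analysis"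
begin

definition partial :: "'n::finite \<Rightarrow> (real^'n \<Rightarrow> real) \<Rightarrow> real^'n \<Rightarrow> real" where
  "partial i f = (\<lambda>x. deriv (\<lambda>t. f (x + t *\<^sub>R axis i 1)) 0)"

definition laplacian :: "(real^'n::finite \<Rightarrow> real) \<Rightarrow> real^'n \<Rightarrow> real" where
  "laplacian f = (\<lambda>x. \<Sum>i\<in>UNIV. partial i (partial i f) x)"

definition iter_laplacian :: "nat \<Rightarrow> (real^'n::finite \<Rightarrow> real) \<Rightarrow> real^'n \<Rightarrow> real" where
  "iter_laplacian m f = (laplacian ^^ m) f"

definition smooth_on :: "(real^'n::finite) set \<Rightarrow> (real^'n \<Rightarrow> real) \<Rightarrow> bool" where
  "smooth_on S f \<longleftrightarrow> (\<forall>is :: 'n list. (fold partial is f) differentiable_on S)"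

end

theory Submission
  imports Defs
begin

text \<open>
  Since \<open>m\<close> is odd, \<open>(|x|\<^sup>2 + \<tau>) powr (- (n - 2 m) / 2)\<close> has nonnegative \<open>- \<Delta>\<^sup>m\<close>. The solution
  is a superposition of such bubbles, centred at points \<open>x\<^sub>j\<close> with \<open>|x\<^sub>j| = R\<^sub>j \<rightarrow> 0\<close>, with height
  \<open>\<epsilon>\<^sub>j R\<^sub>j powr (2 - n)\<close> at distance \<open>R\<^sub>j\<close> from the centre and with the width for which
  \<open>- \<Delta>\<^sup>m u = u\<^sup>\<lambda>\<close> at the centre; then \<open>u (x\<^sub>j)\<close> is a constant times \<open>\<epsilon>\<^sub>j powr (2 m / D) * R\<^sub>j powr (- a)\<close>
  with \<open>D = n - \<lambda> (n - 2 m)\<close>, and \<open>R\<^sub>j\<close> is taken so small that \<open>\<phi> (R\<^sub>j)\<close> is much smaller than the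
  first factor. The lower bound on \<open>\<lambda>\<close> makes the widths negligible compared to \<open>R\<^sub>j\<close>.

  Each bubble is cut off at distance comparable to \<open>R\<^sub>j\<close> from its centre, which spoils the sign of
  \<open>\<Delta>\<^sup>m\<close> in an annulus \<open>|x| \<sim> R\<^sub>j\<close>. This is repaired by subtracting a nonnegative radial function \<open>V\<close>,
  supported in \<open>|x| \<le> C R\<^sub>j\<close> and bounded by \<open>C \<epsilon>\<^sub>j |x| powr (2 - n)\<close>, such that \<open>\<Delta>\<^sup>m V\<close> is a bump that is
  positive on the annulus. All sums are then locally finite, a multiple of the \<open>m\<close>-harmonic function
  \<open>|x| powr (2 - n)\<close> restores positivity, and its \<open>\<lambda>\<close>-th power dominates the regular part of the source.
\<close>

section \<open>Smooth functions of a real variable\<close>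

text \<open>The recursion strips the innermost derivative, so inductions on the order run with the
  function generalised. Order \<open>k\<close> asks that \<open>f\<close> and its first
  \<open>k\<close> derivatives be differentiable on \<open>J\<close>.\<close>

fun diff_upto :: "nat \<Rightarrow> real set \<Rightarrow> (real \<Rightarrow> real) \<Rightarrow> bool" where
  "diff_upto 0 J f \<longleftrightarrow> (\<forall>x\<in>J. f field_differentiable at x)"
| "diff_upto (Suc k) J f \<longleftrightarrow> (\<forall>x\<in>J. f field_differentiable at x) \<and> diff_upto k J (deriv f)"

definition smooth_real_on :: "real set \<Rightarrow> (real \<Rightarrow> real) \<Rightarrow> bool" where
  "smooth_real_on J f \<longleftrightarrow> (\<forall>k. diff_upto k J f)"

lemma diff_upto_differentiable: "diff_upto k J f \<Longrightarrow> x \<in> J \<Longrightarrow> f field_differentiable at x"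
  by (cases k) auto

lemma diff_upto_has_deriv:
  "diff_upto k J f \<Longrightarrow> x \<in> J \<Longrightarrow> (f has_real_derivative deriv f x) (at x)"
  using diff_upto_differentiable DERIV_deriv_iff_field_differentiable by blast

lemma diff_upto_SucD: "diff_upto (Suc k) J f \<Longrightarrow> diff_upto k J f"
  by (induction k arbitrary: f) auto

lemma deriv_cong_open:
  fixes f g :: "real \<Rightarrow> real"
  assumes "open J" "x \<in> J" "\<And>y. y \<in> J \<Longrightarrow> f y = g y"
  shows "deriv f x = deriv g x"
proof (rule deriv_cong_ev)
  show "\<forall>\<^sub>F y in nhds x. f y = g y"
    using assms eventually_nhds by blast
qed simp

lemma field_differentiable_cong_open:
  fixes f g :: "real \<Rightarrow> real"
  assumes "open J" "x \<in> J" "\<And>y. y \<in> J \<Longrightarrow> f y = g y" "f field_differentiable at x"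
  shows "g field_differentiable at x"
  using assms has_field_derivative_transform_within_open[of f _ x J g]
  unfolding field_differentiable_def by blast

lemma diff_upto_cong:
  assumes "open J" "\<And>y. y \<in> J \<Longrightarrow> f y = g y" "diff_upto k J f"
  shows "diff_upto k J g"
  using assms(2,3)
proof (induction k arbitrary: f g)
  case 0
  then show ?case using field_differentiable_cong_open[OF assms(1), of _ f g] by auto
next
  case (Suc k)
  have "deriv f y = deriv g y" if "y \<in> J" for y
    using that by (rule deriv_cong_open[OF assms(1)]) (rule Suc.prems(1))
  then have "diff_upto k J (deriv g)"
    using Suc.prems(2) by (intro Suc.IH[of "deriv f" "deriv g"]) simp_all
  moreover have "g field_differentiable at x" if "x \<in> J" for x
    using field_differentiable_cong_open[OF assms(1) that Suc.prems(1)] Suc.prems(2) that by simp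
  ultimately show ?case by simp
qed

text \<open>The total function \<open>deriv f\<close> agrees with \<open>f'\<close> only on
  \<open>J\<close>; since \<open>J\<close> is open, all further derivatives agree there too.
  Inductions can thus work with explicit derivatives.\<close>

lemma diff_upto_SucI:
  assumes "open J" "\<And>x. x \<in> J \<Longrightarrow> (f has_real_derivative f' x) (at x)" "diff_upto k J f'"
  shows "diff_upto (Suc k) J f"
proof -
  have "deriv f x = f' x" if "x \<in> J" for x
    using assms(2)[OF that] by (rule DERIV_imp_deriv)
  then have "diff_upto k J (deriv f)"
    by (intro diff_upto_cong[OF assms(1) _ assms(3)]) simp
  then show ?thesis
    using assms(2) by (auto simp: field_differentiable_def)
qed

lemma diff_upto_const: "diff_upto k J (\<lambda>x. c)"
  by (induction k arbitrary: c) auto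

lemma diff_upto_id: "diff_upto k J (\<lambda>x. x)"
  by (cases k) (auto simp: diff_upto_const)

lemma diff_upto_add:
  assumes "open J" "diff_upto k J f" "diff_upto k J g"
  shows "diff_upto k J (\<lambda>x. f x + g x)"
  using assms(2,3)
proof (induction k arbitrary: f g)
  case 0
  then show ?case by (auto intro: field_differentiable_add)
next
  case (Suc k)
  show ?case
  proof (rule diff_upto_SucI[OF assms(1)])
    show "diff_upto k J (\<lambda>x. deriv f x + deriv g x)"
      using Suc by auto
    show "((\<lambda>x. f x + g x) has_real_derivative deriv f x + deriv g x) (at x)" if "x \<in> J" for x
      by (intro DERIV_add diff_upto_has_deriv[OF Suc.prems(1) that] diff_upto_has_deriv[OF Suc.prems(2) that])
  qed
qed

lemma diff_upto_mult:
  assumes "open J" "diff_upto k J f" "diff_upto k J g"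
  shows "diff_upto k J (\<lambda>x. f x * g x)"
  using assms(2,3)
proof (induction k arbitrary: f g)
  case 0
  then show ?case by (auto intro: field_differentiable_mult)
next
  case (Suc k)
  show ?case
  proof (rule diff_upto_SucI[OF assms(1)])
    show "diff_upto k J (\<lambda>x. deriv f x * g x + deriv g x * f x)"
      using Suc diff_upto_SucD by (intro diff_upto_add[OF assms(1)]) auto
    show "((\<lambda>x. f x * g x) has_real_derivative deriv f x * g x + deriv g x * f x) (at x)" if "x \<in> J" for x
      by (intro DERIV_mult diff_upto_has_deriv[OF Suc.prems(1) that] diff_upto_has_deriv[OF Suc.prems(2) that])
  qed
qed

lemma diff_upto_compose:
  assumes "open J" "f ` J \<subseteq> I" "diff_upto k J f" "diff_upto k I g"
  shows "diff_upto k J (\<lambda>x. g (f x))"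
  using assms(3,4)
proof (induction k arbitrary: g)
  case 0
  then show ?case
    using field_differentiable_compose[of f _ g] assms(2) by (auto simp: o_def)
next
  case (Suc k)
  show ?case
  proof (rule diff_upto_SucI[OF assms(1)])
    show "diff_upto k J (\<lambda>x. deriv g (f x) * deriv f x)"
      using Suc diff_upto_SucD by (intro diff_upto_mult[OF assms(1)]) auto
    show "((\<lambda>x. g (f x)) has_real_derivative deriv g (f x) * deriv f x) (at x)" if "x \<in> J" for x
    proof -
      have "(g has_real_derivative deriv g (f x)) (at (f x))"
        using diff_upto_has_deriv[OF Suc.prems(2)] that assms(2) by auto
      then show ?thesis
        by (rule DERIV_chain2) (rule diff_upto_has_deriv[OF Suc.prems(1) that])
    qed
  qed
qed

lemma diff_upto_subset: "diff_upto k J f \<Longrightarrow> I \<subseteq> J \<Longrightarrow> diff_upto k I f"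
  by (induction k arbitrary: f) auto

lemma smooth_real_on_subset: "smooth_real_on J f \<Longrightarrow> I \<subseteq> J \<Longrightarrow> smooth_real_on I f"
  using diff_upto_subset unfolding smooth_real_on_def by blast

lemma smooth_real_on_const [intro!]: "smooth_real_on J (\<lambda>x. c)"
  by (simp add: smooth_real_on_def diff_upto_const)

lemma smooth_real_on_id [intro!]: "smooth_real_on J (\<lambda>x. x)"
  by (simp add: smooth_real_on_def diff_upto_id)

lemma smooth_real_on_add:
  "open J \<Longrightarrow> smooth_real_on J f \<Longrightarrow> smooth_real_on J g \<Longrightarrow> smooth_real_on J (\<lambda>x. f x + g x)"
  by (simp add: smooth_real_on_def diff_upto_add)

lemma smooth_real_on_mult:
  "open J \<Longrightarrow> smooth_real_on J f \<Longrightarrow> smooth_real_on J g \<Longrightarrow> smooth_real_on J (\<lambda>x. f x * g x)"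
  by (simp add: smooth_real_on_def diff_upto_mult)

lemma smooth_real_on_diff:
  assumes "open J" "smooth_real_on J f" "smooth_real_on J g"
  shows "smooth_real_on J (\<lambda>x. f x - g x)"
  using smooth_real_on_add[OF assms(1,2) smooth_real_on_mult[OF assms(1) smooth_real_on_const[of J "-1"] assms(3)]]
  by simp

lemma smooth_real_on_compose:
  "open J \<Longrightarrow> f ` J \<subseteq> I \<Longrightarrow> smooth_real_on J f \<Longrightarrow> smooth_real_on I g \<Longrightarrow> smooth_real_on J (\<lambda>x. g (f x))"
  unfolding smooth_real_on_def using diff_upto_compose by blast

lemma smooth_real_on_deriv: "smooth_real_on J f \<Longrightarrow> smooth_real_on J (deriv f)"
  unfolding smooth_real_on_def using diff_upto.simps(2) by blast

lemma smooth_real_on_has_deriv: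
  "smooth_real_on J f \<Longrightarrow> x \<in> J \<Longrightarrow> (f has_real_derivative deriv f x) (at x)"
  unfolding smooth_real_on_def using diff_upto_has_deriv by blast

lemma smooth_real_on_continuous: "smooth_real_on J f \<Longrightarrow> continuous_on J f"
  by (intro continuous_at_imp_continuous_on ballI) (rule DERIV_isCont[OF smooth_real_on_has_deriv])

lemma smooth_real_onI:
  assumes "open J" "\<And>x. x \<in> J \<Longrightarrow> (f has_real_derivative f' x) (at x)" "smooth_real_on J f'"
  shows "smooth_real_on J f"
proof -
  have "diff_upto (Suc k) J f" for k
    using assms by (intro diff_upto_SucI[of J f f' k]) (auto simp: smooth_real_on_def)
  then show ?thesis
    using diff_upto_SucD unfolding smooth_real_on_def by blast
qed

lemma smooth_real_on_powr: "smooth_real_on {0<..} (\<lambda>t. t powr p)"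
proof -
  have "diff_upto k {0<..} (\<lambda>t::real. t powr p)" for k
  proof (induction k arbitrary: p)
    case 0
    then show ?case
      by (auto simp: field_differentiable_def intro!: exI has_real_derivative_powr)
  next
    case (Suc k)
    show ?case
    proof (rule diff_upto_SucI)
      show "diff_upto k {0<..} (\<lambda>t. p * t powr (p - 1))"
        by (intro diff_upto_mult diff_upto_const Suc open_greaterThan)
      show "((\<lambda>t. t powr p) has_real_derivative p * t powr (p - 1)) (at t)" if "t \<in> {0<..}" for t
        using that by (auto intro: has_real_derivative_powr)
    qed auto
  qed
  then show ?thesis by (simp add: smooth_real_on_def)
qed

section \<open>The flat functions built from exp (-1/t)\<close>

definition flat :: "nat \<Rightarrow> real \<Rightarrow> real" where
  "flat k t = (if t \<le> 0 then 0 else (1 / t) ^ k * exp (- (1 / t)))"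

text \<open>The index \<open>k\<close> makes the family closed, up to linear combinations, under
  differentiation, which turns smoothness into an induction. At 0 the right difference quotient is
  \<open>flat (k + 1)\<close>, where exponential decay beats the power.\<close>

lemma flat_has_deriv:
  "(flat k has_real_derivative (flat (k + 2) t - real k * flat (k + 1) t)) (at t)"
proof -
  consider "t < 0" | "t > 0" | "t = 0" by linarith
  then show ?thesis
  proof cases
    case 1
    have "((\<lambda>_. 0) has_real_derivative 0) (at t)" by simp
    then have "(flat k has_real_derivative 0) (at t)"
      by (rule has_field_derivative_transform_within_open[of _ _ _ "{..<0}"])
        (use 1 in \<open>auto simp: flat_def\<close>)
    then show ?thesis using 1 by (simp add: flat_def)
  next
    case 2
    have "((\<lambda>t. (1 / t) ^ k * exp (- (1 / t))) has_real_derivative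
        (flat (k + 2) t - real k * flat (k + 1) t)) (at t)"
    proof -
      have inv: "((\<lambda>t. 1 / t) has_real_derivative - (1 / t)\<^sup>2) (at t)"
        using 2 by (auto intro!: derivative_eq_intros simp: power2_eq_square)
      \<comment> \<open>For \<open>k = 0\<close> the truncated exponent \<open>k - 1\<close> does no
        harm, since the factor \<open>real k\<close> vanishes.\<close>
      have p: "real k * (1 / t) ^ (k - 1) * - (1 / t)\<^sup>2 = - (real k * (1 / t) ^ (k + 1))"
        by (cases k) (auto simp: power2_eq_square)
      have "((\<lambda>t. (1 / t) ^ k) has_real_derivative - (real k * (1 / t) ^ (k + 1))) (at t)"
        using DERIV_power[OF inv, of k] p by (simp add: mult_ac)
      moreover have "((\<lambda>t. exp (- (1 / t))) has_real_derivative exp (- (1 / t)) * (1 / t)\<^sup>2) (at t)"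
        using DERIV_fun_exp[OF DERIV_minus[OF inv]] by simp
      ultimately have "((\<lambda>t. (1 / t) ^ k * exp (- (1 / t))) has_real_derivative
        - (real k * (1 / t) ^ (k + 1)) * exp (- (1 / t)) + exp (- (1 / t)) * (1 / t)\<^sup>2 * (1 / t) ^ k) (at t)"
        by (rule DERIV_mult)
      then show ?thesis
        using 2 by (simp add: flat_def power_add mult_ac power2_eq_square)
    qed
    then show ?thesis
      by (rule has_field_derivative_transform_within_open[of _ _ _ "{0<..}"])
        (use 2 in \<open>auto simp: flat_def\<close>)
  next
    case 3
    have "((\<lambda>y::real. y ^ Suc k / exp y) \<longlongrightarrow> 0) at_top" by (rule tendsto_power_div_exp_0)
    then have "((\<lambda>h::real. inverse h ^ Suc k / exp (inverse h)) \<longlongrightarrow> 0) (at_right 0)"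
      by (rule filterlim_compose) (rule filterlim_inverse_at_top_right)
    then have r: "((\<lambda>h. flat k h / h) \<longlongrightarrow> 0) (at_right 0)"
    proof (rule Lim_transform_eventually)
      show "\<forall>\<^sub>F h in at_right 0. inverse h ^ Suc k / exp (inverse h) = flat k h / h"
        using eventually_at_right_less[of "0::real"]
        by eventually_elim (simp add: flat_def exp_minus divide_inverse mult_ac)
    qed
    have "((\<lambda>h. 0::real) \<longlongrightarrow> 0) (at_left 0)" by simp
    then have l: "((\<lambda>h. flat k h / h) \<longlongrightarrow> 0) (at_left 0)"
    proof (rule Lim_transform_eventually)
      show "\<forall>\<^sub>F h in at_left 0. 0 = flat k h / h"
        by (auto simp: eventually_at_filter flat_def)
    qed
    have "((\<lambda>h. (flat k (0 + h) - flat k 0) / h) \<longlongrightarrow> 0) (at 0)"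
      using filterlim_split_at[OF l r] by (simp add: flat_def)
    then have "(flat k has_real_derivative 0) (at 0)"
      unfolding DERIV_def .
    then show ?thesis using 3 by (simp add: flat_def)
  qed
qed

lemma smooth_real_on_flat: "smooth_real_on UNIV (flat k)"
proof -
  have "diff_upto j UNIV (flat k)" for j
  proof (induction j arbitrary: k)
    case 0
    then show ?case using flat_has_deriv by (auto simp: field_differentiable_def)
  next
    case (Suc j)
    show ?case
    proof (rule diff_upto_SucI)
      show "diff_upto j UNIV (\<lambda>t. flat (k + 2) t + (- real k) * flat (k + 1) t)"
        by (intro diff_upto_add diff_upto_mult diff_upto_const Suc open_UNIV)
      show "(flat k has_real_derivative flat (k + 2) t + (- real k) * flat (k + 1) t) (at t)" for t
        using flat_has_deriv[of k t] by simp
    qed auto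
  qed
  then show ?thesis by (simp add: smooth_real_on_def)
qed

lemma smooth_real_on_flat_compose:
  "open J \<Longrightarrow> smooth_real_on J f \<Longrightarrow> smooth_real_on J (\<lambda>t. flat k (f t))"
  by (rule smooth_real_on_compose[OF _ _ _ smooth_real_on_flat]) auto

section \<open>Smooth functions of several variables\<close>

text \<open>A recursive form of \<open>smooth_on\<close>, graded by order. As \<open>fold\<close>
  applies the head of the list first, stripping the head corresponds to stripping the innermost
  partial derivative.\<close>

fun partials_upto :: "nat \<Rightarrow> (real^'n::finite) set \<Rightarrow> (real^'n \<Rightarrow> real) \<Rightarrow> bool" where
  "partials_upto 0 S f \<longleftrightarrow> f differentiable_on S"
| "partials_upto (Suc k) S f \<longleftrightarrow> f differentiable_on S \<and> (\<forall>i. partials_upto k S (partial i f))"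

lemma partials_upto_iff:
  "partials_upto k S f \<longleftrightarrow> (\<forall>is. length is \<le> k \<longrightarrow> fold partial is f differentiable_on S)"
proof (induction k arbitrary: f)
  case 0
  then show ?case by auto
next
  case (Suc k)
  show ?case
  proof
    assume L: "partials_upto (Suc k) S f"
    show "\<forall>is. length is \<le> Suc k \<longrightarrow> fold partial is f differentiable_on S"
    proof (intro allI impI)
      fix "is" :: "'a list" assume "length is \<le> Suc k"
      then show "fold partial is f differentiable_on S"
        using L Suc.IH by (cases "is") auto
    qed
  next
    assume R: "\<forall>is. length is \<le> Suc k \<longrightarrow> fold partial is f differentiable_on S"
    have "partials_upto k S (partial i f)" for i
      unfolding Suc.IH
    proof (intro allI impI)
      fix "is" :: "'a list" assume "length is \<le> k"
      then show "fold partial is (partial i f) differentiable_on S"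
        using R[rule_format, of "i # is"] by simp
    qed
    then show "partials_upto (Suc k) S f"
      using R[rule_format, of "[]"] by simp
  qed
qed

lemma smooth_on_iff: "smooth_on S f \<longleftrightarrow> (\<forall>k. partials_upto k S f)"
  unfolding smooth_on_def partials_upto_iff by blast

lemma partials_upto_SucD: "partials_upto (Suc k) S f \<Longrightarrow> partials_upto k S f"
  unfolding partials_upto_iff by auto

lemma partials_upto_has_derivative:
  assumes "open S" "partials_upto k S f" "x \<in> S"
  shows "\<exists>f'. (f has_derivative f') (at x)"
proof -
  have "f differentiable_on S" using assms(2) by (cases k) auto
  then show ?thesis
    using assms(1,3) differentiable_on_eq_differentiable_at differentiable_def by blast
qed

lemma has_derivative_partial:
  fixes f :: "real^'n::finite \<Rightarrow> real"
  assumes "(f has_derivative f') (at x)"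
  shows "((\<lambda>t. f (x + t *\<^sub>R axis i 1)) has_real_derivative f' (axis i 1)) (at 0)"
    and "partial i f x = f' (axis i 1)"
proof -
  have "((\<lambda>t. x + t *\<^sub>R axis i 1) has_derivative (\<lambda>t. t *\<^sub>R axis i 1)) (at 0)"
    by (auto intro!: derivative_eq_intros)
  moreover have "(f has_derivative f') (at (x + 0 *\<^sub>R axis i 1))"
    using assms by simp
  ultimately have "((\<lambda>t. f (x + t *\<^sub>R axis i 1)) has_derivative (\<lambda>t. f' (t *\<^sub>R axis i 1))) (at 0)"
    by (rule has_derivative_compose)
  moreover have "(\<lambda>t. f' (t *\<^sub>R axis i 1)) = (*) (f' (axis i 1))"
    using has_derivative_linear[OF assms] by (auto simp: linear_cmul mult.commute)
  ultimately show "((\<lambda>t. f (x + t *\<^sub>R axis i 1)) has_real_derivative f' (axis i 1)) (at 0)"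
    by (simp add: has_field_derivative_def)
  then show "partial i f x = f' (axis i 1)"
    unfolding partial_def by (rule DERIV_imp_deriv)
qed

lemma partial_cong_open:
  fixes f g :: "real^'n::finite \<Rightarrow> real"
  assumes "open S" "x \<in> S" "\<And>y. y \<in> S \<Longrightarrow> f y = g y"
  shows "partial i f x = partial i g x"
proof -
  have "((\<lambda>t. x + t *\<^sub>R axis i 1) \<longlongrightarrow> x + 0 *\<^sub>R axis i 1) (nhds (0::real))"
    by (intro tendsto_intros) (rule filterlim_ident)
  then have "\<forall>\<^sub>F t in nhds (0::real). x + t *\<^sub>R axis i 1 \<in> S"
    using assms(1,2) by (auto dest: topological_tendstoD)
  then have "\<forall>\<^sub>F t in nhds (0::real). f (x + t *\<^sub>R axis i 1) = g (x + t *\<^sub>R axis i 1)"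
    by eventually_elim (rule assms(3))
  then show ?thesis
    unfolding partial_def by (rule deriv_cong_ev) simp
qed

lemma laplacian_cong_open:
  fixes f g :: "real^'n::finite \<Rightarrow> real"
  assumes "open S" "x \<in> S" "\<And>y. y \<in> S \<Longrightarrow> f y = g y"
  shows "laplacian f x = laplacian g x"
proof -
  have "partial i f y = partial i g y" if "y \<in> S" for i y
    by (rule partial_cong_open[OF assms(1) that assms(3)])
  then show ?thesis
    unfolding laplacian_def by (intro sum.cong refl partial_cong_open[OF assms(1,2)])
qed

lemma iter_laplacian_0 [simp]: "iter_laplacian 0 f = f"
  by (simp add: iter_laplacian_def)

lemma iter_laplacian_Suc: "iter_laplacian (Suc k) f = laplacian (iter_laplacian k f)"
  by (simp add: iter_laplacian_def)

lemma iter_laplacian_cong_open: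
  fixes f g :: "real^'n::finite \<Rightarrow> real"
  assumes "open S" "x \<in> S" "\<And>y. y \<in> S \<Longrightarrow> f y = g y"
  shows "iter_laplacian k f x = iter_laplacian k g x"
  using assms(2)
proof (induction k arbitrary: x)
  case 0
  then show ?case using assms(3) by simp
next
  case (Suc k)
  show ?case
    unfolding iter_laplacian_Suc by (rule laplacian_cong_open[OF assms(1) Suc.prems Suc.IH])
qed

lemma differentiable_on_cong_open:
  assumes "open S" "\<And>y. y \<in> S \<Longrightarrow> f y = g y" "f differentiable_on S"
  shows "g differentiable_on S"
  using assms has_derivative_transform_within_open[of f _ _ UNIV S g]
  by (auto simp: differentiable_on_eq_differentiable_at differentiable_def) blast

lemma partials_upto_cong:
  assumes "open S" "\<And>y. y \<in> S \<Longrightarrow> f y = g y" "partials_upto k S f"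
  shows "partials_upto k S g"
  using assms(2,3)
proof (induction k arbitrary: f g)
  case 0
  then show ?case using differentiable_on_cong_open[OF assms(1), of f g] by simp
next
  case (Suc k)
  have "partials_upto k S (partial i g)" for i
  proof (rule Suc.IH)
    show "partial i f y = partial i g y" if "y \<in> S" for y
      using that by (rule partial_cong_open[OF assms(1)]) (rule Suc.prems(1))
    show "partials_upto k S (partial i f)"
      using Suc.prems(2) by simp
  qed
  moreover have "g differentiable_on S"
    using Suc.prems differentiable_on_cong_open[OF assms(1), of f g] by simp
  ultimately show ?case by simp
qed

lemma partials_upto_SucI:
  assumes "open S"
    and "\<And>x. x \<in> S \<Longrightarrow> (f has_derivative f' x) (at x)"
    and "\<And>i. partials_upto k S (\<lambda>x. f' x (axis i 1))"
  shows "partials_upto (Suc k) S f"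
proof -
  have "f differentiable_on S"
    using assms(1,2) differentiable_on_eq_differentiable_at differentiable_def by blast
  moreover have "partials_upto k S (partial i f)" for i
    by (rule partials_upto_cong[OF assms(1) _ assms(3)])
      (simp add: has_derivative_partial(2)[OF assms(2)])
  ultimately show ?thesis by simp
qed

lemma partials_upto_const: "partials_upto k S (\<lambda>x. c)"
proof (induction k arbitrary: c)
  case (Suc k)
  have "partial i (\<lambda>x :: real^'a. c) = (\<lambda>x. 0)" for i
    by (simp add: partial_def fun_eq_iff)
  then show ?case using Suc by simp
qed simp

lemma partial_add:
  assumes "(f has_derivative f') (at x)" "(g has_derivative g') (at x)"
  shows "partial i (\<lambda>x. f x + g x) x = partial i f x + partial i g x"
  using has_derivative_partial(2)[OF has_derivative_add[OF assms]]
  by (simp add: has_derivative_partial(2)[OF assms(1)] has_derivative_partial(2)[OF assms(2)])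

lemma partials_upto_add:
  assumes "open S" "partials_upto k S f" "partials_upto k S g"
  shows "partials_upto k S (\<lambda>x. f x + g x)"
  using assms(2,3)
proof (induction k arbitrary: f g)
  case 0
  then show ?case by simp
next
  case (Suc k)
  have "partials_upto k S (partial i (\<lambda>x. f x + g x))" for i
  proof (rule partials_upto_cong[OF assms(1)])
    show "partials_upto k S (\<lambda>x. partial i f x + partial i g x)"
      using Suc by simp
    show "partial i f x + partial i g x = partial i (\<lambda>x. f x + g x) x" if "x \<in> S" for x
    proof -
      obtain f' g' where "(f has_derivative f') (at x)" "(g has_derivative g') (at x)"
        using partials_upto_has_derivative[OF assms(1) _ \<open>x \<in> S\<close>] Suc.prems by blast
      then show ?thesis by (rule partial_add[symmetric])
    qed
  qed
  then show ?case using Suc.prems by simp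
qed

lemma partial_mult:
  assumes "(f has_derivative f') (at x)" "(g has_derivative g') (at x)"
  shows "partial i (\<lambda>x. f x * g x) x = f x * partial i g x + partial i f x * g x"
  using has_derivative_partial(2)[OF has_derivative_mult[OF assms]]
  by (simp add: has_derivative_partial(2)[OF assms(1)] has_derivative_partial(2)[OF assms(2)])

lemma partials_upto_mult:
  assumes "open S" "partials_upto k S f" "partials_upto k S g"
  shows "partials_upto k S (\<lambda>x. f x * g x)"
  using assms(2,3)
proof (induction k arbitrary: f g)
  case 0
  then show ?case by simp
next
  case (Suc k)
  have "partials_upto k S (partial i (\<lambda>x. f x * g x))" for i
  proof (rule partials_upto_cong[OF assms(1)])
    show "partials_upto k S (\<lambda>x. f x * partial i g x + partial i f x * g x)"
      using Suc by (intro partials_upto_add assms(1) Suc.IH partials_upto_SucD[of k S f]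
          partials_upto_SucD[of k S g]) simp_all
    show "f x * partial i g x + partial i f x * g x = partial i (\<lambda>x. f x * g x) x" if "x \<in> S" for x
    proof -
      obtain f' g' where "(f has_derivative f') (at x)" "(g has_derivative g') (at x)"
        using partials_upto_has_derivative[OF assms(1) _ \<open>x \<in> S\<close>] Suc.prems by blast
      then show ?thesis by (rule partial_mult[symmetric])
    qed
  qed
  then show ?case using Suc.prems by simp
qed

lemma partial_compose:
  assumes "(f has_derivative f') (at x)" "(g has_real_derivative g') (at (f x))"
  shows "((\<lambda>x. g (f x)) has_derivative (\<lambda>h. g' * f' h)) (at x)"
    and "partial i (\<lambda>x. g (f x)) x = g' * partial i f x"
proof -
  show *: "((\<lambda>x. g (f x)) has_derivative (\<lambda>h. g' * f' h)) (at x)"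
    using has_derivative_compose[OF assms(1)] assms(2) by (simp add: has_field_derivative_def)
  show "partial i (\<lambda>x. g (f x)) x = g' * partial i f x"
    by (simp add: has_derivative_partial(2)[OF *] has_derivative_partial(2)[OF assms(1)])
qed

lemma partials_upto_compose:
  assumes "open S" "f ` S \<subseteq> J" "partials_upto k S f" "diff_upto k J g"
  shows "partials_upto k S (\<lambda>x. g (f x))"
  using assms(3,4)
proof (induction k arbitrary: g)
  case 0
  have "(\<lambda>x. g (f x)) differentiable (at x)" if "x \<in> S" for x
  proof -
    obtain f' where "(f has_derivative f') (at x)"
      using partials_upto_has_derivative[OF assms(1) 0(1) \<open>x \<in> S\<close>] by blast
    moreover have "(g has_real_derivative deriv g (f x)) (at (f x))"
      using that assms(2) by (intro diff_upto_has_deriv[OF 0(2)]) auto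
    ultimately show ?thesis
      using partial_compose(1) differentiableI by blast
  qed
  then show ?case using assms(1) by (simp add: differentiable_on_eq_differentiable_at)
next
  case (Suc k)
  have d: "(\<lambda>x. g (f x)) differentiable (at x)"
    and e: "deriv g (f x) * partial i f x = partial i (\<lambda>x. g (f x)) x" if "x \<in> S" for x i
  proof -
    obtain f' where f': "(f has_derivative f') (at x)"
      using partials_upto_has_derivative[OF assms(1) Suc.prems(1) \<open>x \<in> S\<close>] by blast
    have g': "(g has_real_derivative deriv g (f x)) (at (f x))"
      using that assms(2) by (intro diff_upto_has_deriv[OF Suc.prems(2)]) auto
    show "(\<lambda>x. g (f x)) differentiable (at x)"
      using partial_compose(1)[OF f' g'] by (rule differentiableI)
    show "deriv g (f x) * partial i f x = partial i (\<lambda>x. g (f x)) x"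
      using partial_compose(2)[OF f' g'] by simp
  qed
  have "partials_upto k S (partial i (\<lambda>x. g (f x)))" for i
  proof (rule partials_upto_cong[OF assms(1)])
    show "deriv g (f x) * partial i f x = partial i (\<lambda>x. g (f x)) x" if "x \<in> S" for x
      using that by (rule e)
    show "partials_upto k S (\<lambda>x. deriv g (f x) * partial i f x)"
    proof (rule partials_upto_mult[OF assms(1)])
      show "partials_upto k S (\<lambda>x. deriv g (f x))"
        using Suc.prems(2) by (intro Suc.IH[OF partials_upto_SucD[OF Suc.prems(1)]]) simp
      show "partials_upto k S (partial i f)"
        using Suc.prems(1) by simp
    qed
  qed
  then show ?case using d assms(1) by (simp add: differentiable_on_eq_differentiable_at)
qed

lemma smooth_on_cong:
  "open S \<Longrightarrow> smooth_on S f \<Longrightarrow> (\<And>y. y \<in> S \<Longrightarrow> f y = g y) \<Longrightarrow> smooth_on S g"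
  unfolding smooth_on_iff by (blast intro: partials_upto_cong[of S f g])

lemma smooth_on_partial: "smooth_on S f \<Longrightarrow> smooth_on S (partial i f)"
  unfolding smooth_on_iff using partials_upto.simps(2) by blast

lemma smooth_on_const: "smooth_on S (\<lambda>x. c)"
  by (simp add: smooth_on_iff partials_upto_const)

lemma smooth_on_add:
  "open S \<Longrightarrow> smooth_on S f \<Longrightarrow> smooth_on S g \<Longrightarrow> smooth_on S (\<lambda>x. f x + g x)"
  by (simp add: smooth_on_iff partials_upto_add)

lemma smooth_on_mult:
  "open S \<Longrightarrow> smooth_on S f \<Longrightarrow> smooth_on S g \<Longrightarrow> smooth_on S (\<lambda>x. f x * g x)"
  by (simp add: smooth_on_iff partials_upto_mult)

lemma smooth_on_compose:
  "open S \<Longrightarrow> f ` S \<subseteq> J \<Longrightarrow> smooth_on S f \<Longrightarrow> smooth_real_on J g \<Longrightarrow> smooth_on S (\<lambda>x. g (f x))"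
  unfolding smooth_on_iff smooth_real_on_def by (blast intro: partials_upto_compose)

lemma smooth_on_sum:
  "open S \<Longrightarrow> (\<And>j. j \<in> I \<Longrightarrow> smooth_on S (f j)) \<Longrightarrow> smooth_on S (\<lambda>x. \<Sum>j\<in>I. f j x)"
  by (induction I rule: infinite_finite_induct) (auto intro: smooth_on_const smooth_on_add)

lemma smooth_on_subset: "smooth_on S f \<Longrightarrow> T \<subseteq> S \<Longrightarrow> smooth_on T f"
  unfolding smooth_on_def using differentiable_on_subset by blast

text \<open>Differentiability at a point is local, so each iterated partial can be tested in a
  neighbourhood. This is what a sum that is only locally finite requires.\<close>

lemma smooth_on_locally:
  assumes "\<And>x. x \<in> S \<Longrightarrow> \<exists>T. open T \<and> x \<in> T \<and> smooth_on T f"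
  shows "smooth_on S f"
  unfolding smooth_on_def
proof (intro allI)
  fix "is" :: "'a list"
  have "fold partial is f differentiable (at x)" if x: "x \<in> S" for x
  proof -
    obtain T where "open T" "x \<in> T" "smooth_on T f" using assms[OF x] by blast
    then show ?thesis
      unfolding smooth_on_def using differentiable_on_eq_differentiable_at by blast
  qed
  then show "fold partial is f differentiable_on S"
    using differentiable_at_imp_differentiable_on by blast
qed

lemma smooth_on_has_derivative:
  "open S \<Longrightarrow> smooth_on S f \<Longrightarrow> x \<in> S \<Longrightarrow> \<exists>f'. (f has_derivative f') (at x)"
  unfolding smooth_on_iff using partials_upto_has_derivative by blast

lemma smooth_on_laplacian: "open S \<Longrightarrow> smooth_on S f \<Longrightarrow> smooth_on S (laplacian f)"
  unfolding laplacian_def by (intro smooth_on_sum smooth_on_partial)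

lemma smooth_on_iter_laplacian: "open S \<Longrightarrow> smooth_on S f \<Longrightarrow> smooth_on S (iter_laplacian k f)"
  by (induction k) (auto simp: iter_laplacian_Suc intro: smooth_on_laplacian)

section \<open>Linearity of the iterated Laplacian on smooth functions\<close>

lemma partial_lin:
  assumes "open S" "x \<in> S" "smooth_on S f" "smooth_on S g"
  shows "partial i (\<lambda>x. f x + c * g x) x = partial i f x + c * partial i g x"
proof -
  obtain f' g' where f': "(f has_derivative f') (at x)" and g': "(g has_derivative g') (at x)"
    using smooth_on_has_derivative[OF assms(1)] assms by blast
  have "((\<lambda>x. f x + c * g x) has_derivative (\<lambda>h. f' h + c * g' h)) (at x)"
    using f' g' by (auto intro!: derivative_eq_intros)
  from has_derivative_partial(2)[OF this] show ?thesis
    by (simp add: has_derivative_partial(2)[OF f'] has_derivative_partial(2)[OF g'])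
qed

lemma laplacian_lin:
  assumes "open S" "x \<in> S" "smooth_on S f" "smooth_on S g"
  shows "laplacian (\<lambda>x. f x + c * g x) x = laplacian f x + c * laplacian g x"
proof -
  have "partial i (partial i (\<lambda>x. f x + c * g x)) x
      = partial i (partial i f) x + c * partial i (partial i g) x" for i
  proof -
    have "partial i (partial i (\<lambda>x. f x + c * g x)) x
        = partial i (\<lambda>x. partial i f x + c * partial i g x) x"
      by (rule partial_cong_open[OF assms(1,2)]) (rule partial_lin[OF assms(1) _ assms(3,4)])
    also have "\<dots> = partial i (partial i f) x + c * partial i (partial i g) x"
      by (rule partial_lin[OF assms(1,2)]) (intro smooth_on_partial assms)+
    finally show ?thesis .
  qed
  then show ?thesis by (simp add: laplacian_def sum.distrib sum_distrib_left)
qed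

lemma iter_laplacian_lin:
  assumes "open S" "x \<in> S" "smooth_on S f" "smooth_on S g"
  shows "iter_laplacian k (\<lambda>x. f x + c * g x) x = iter_laplacian k f x + c * iter_laplacian k g x"
  using assms(2)
proof (induction k arbitrary: x)
  case (Suc k)
  have "iter_laplacian (Suc k) (\<lambda>x. f x + c * g x) x
      = laplacian (\<lambda>x. iter_laplacian k f x + c * iter_laplacian k g x) x"
    unfolding iter_laplacian_Suc by (rule laplacian_cong_open[OF assms(1) Suc.prems Suc.IH])
  also have "\<dots> = iter_laplacian (Suc k) f x + c * iter_laplacian (Suc k) g x"
    unfolding iter_laplacian_Suc
    by (rule laplacian_lin[OF assms(1) Suc.prems]) (intro smooth_on_iter_laplacian assms)+
  finally show ?case .
qed simp

lemma iter_laplacian_sum: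
  assumes "open S" "x \<in> S" "finite I" "\<And>j. j \<in> I \<Longrightarrow> smooth_on S (f j)"
  shows "iter_laplacian k (\<lambda>x. \<Sum>j\<in>I. f j x) x = (\<Sum>j\<in>I. iter_laplacian k (f j) x)"
  using assms(3,4)
proof (induction I rule: finite_induct)
  case empty
  have "iter_laplacian k (\<lambda>x. 0 :: real) = (\<lambda>x :: real^'a. 0)"
    by (induction k) (auto simp: iter_laplacian_Suc laplacian_def partial_def)
  then show ?case by simp
next
  case (insert j I)
  have "iter_laplacian k (\<lambda>x. (\<Sum>j\<in>I. f j x) + 1 * f j x) x
      = iter_laplacian k (\<lambda>x. \<Sum>j\<in>I. f j x) x + 1 * iter_laplacian k (f j) x"
    using insert by (intro iter_laplacian_lin[OF assms(1,2)] smooth_on_sum assms(1)) auto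
  then show ?case using insert by (simp add: add.commute)
qed

section \<open>Radial functions\<close>

text \<open>The Laplacian of the radial function \<open>F (\<kappa> |x - c|\<^sup>2 + \<tau>)\<close> in dimension \<open>n\<close>
  is \<open>\<kappa>\<close> times \<open>radial_op n \<tau> F\<close> at the same point.\<close>
definition radial_op :: "real \<Rightarrow> real \<Rightarrow> (real \<Rightarrow> real) \<Rightarrow> real \<Rightarrow> real" where
  "radial_op n \<tau> F = (\<lambda>t. 4 * (t - \<tau>) * deriv (deriv F) t + 2 * n * deriv F t)"

text \<open>\<open>\<kappa>\<close> rescales lengths and \<open>\<tau>\<close> regularises the
  centre. One form thus serves both the bubbles, with \<open>\<tau>\<close> the relative squared
  width, and the functions singular at the origin, with \<open>\<tau> = 0\<close>.\<close>

definition quadric :: "real \<Rightarrow> real^'n::finite \<Rightarrow> real \<Rightarrow> real^'n \<Rightarrow> real" where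
  "quadric \<kappa> c \<tau> x = \<kappa> * ((x - c) \<bullet> (x - c)) + \<tau>"

lemma quadric_has_derivative:
  "(quadric \<kappa> c \<tau> has_derivative (\<lambda>h. 2 * \<kappa> * (h \<bullet> (x - c)))) (at x)"
  unfolding quadric_def by (auto intro!: derivative_eq_intros simp: inner_commute)

lemma partial_quadric: "partial i (quadric \<kappa> c \<tau>) x = 2 * \<kappa> * (x $ i - c $ i)"
  using has_derivative_partial(2)[OF quadric_has_derivative[of \<kappa> c \<tau> x]]
  by (simp add: inner_axis')

lemma coordinate_has_derivative:
  fixes x :: "real^'n::finite"
  shows "((\<lambda>x. a * (x $ i - b)) has_derivative (\<lambda>h. a * h $ i)) (at x)"
proof -
  have "((\<lambda>x. x $ i) has_derivative (\<lambda>h. h $ i)) (at x)"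
    by (rule bounded_linear_imp_has_derivative[OF bounded_linear_vec_nth])
  then have "((\<lambda>x. x $ i - b) has_derivative (\<lambda>h. h $ i - 0)) (at x)"
    by (intro has_derivative_diff has_derivative_const)
  then show ?thesis
    by (auto dest: has_derivative_mult_right[where x = a])
qed

lemma smooth_on_quadric:
  assumes "open S" shows "smooth_on S (quadric \<kappa> c \<tau>)"
proof -
  have "partials_upto k S (\<lambda>x. a * (x $ i - b))" for k a i b
  proof (cases k)
    case 0
    then show ?thesis
      using coordinate_has_derivative
      by (auto intro!: differentiable_at_imp_differentiable_on differentiableI)
  next
    case (Suc j)
    show ?thesis
      unfolding Suc by (rule partials_upto_SucI[OF assms coordinate_has_derivative partials_upto_const])
  qed
  then have "partials_upto (Suc k) S (quadric \<kappa> c \<tau>)" for k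
    using partials_upto_SucI[OF assms quadric_has_derivative] by (simp add: inner_axis')
  then show ?thesis unfolding smooth_on_iff using partials_upto_SucD by blast
qed

lemma open_vimage_quadric: "open J \<Longrightarrow> open (quadric \<kappa> c \<tau> -` J)"
  by (intro open_vimage) (auto simp: quadric_def intro!: continuous_intros)

lemma smooth_on_radial:
  assumes "open J" "smooth_real_on J F"
  shows "smooth_on (quadric \<kappa> c \<tau> -` J) (\<lambda>x. F (quadric \<kappa> c \<tau> x))"
  by (rule smooth_on_compose[OF open_vimage_quadric[OF assms(1)] _ smooth_on_quadric assms(2)])
    (auto simp: open_vimage_quadric[OF assms(1)])

text \<open>Chain rule: with \<open>q\<close> the quadric, its squared gradient is
  \<open>4 * \<kappa> * (q - \<tau>)\<close> and its Laplacian is \<open>2 * n * \<kappa>\<close>.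
  The result is again a function of \<open>q\<close>, which permits iteration.\<close>

lemma laplacian_radial:
  fixes c :: "real^'n::finite"
  assumes "open J" "smooth_real_on J F" "quadric \<kappa> c \<tau> x \<in> J"
  shows "laplacian (\<lambda>x. F (quadric \<kappa> c \<tau> x)) x
    = \<kappa> * radial_op (real CARD('n)) \<tau> F (quadric \<kappa> c \<tau> x)"
proof -
  let ?q = "quadric \<kappa> c \<tau>" and ?S = "quadric \<kappa> c \<tau> -` J"
  have S: "open ?S" "x \<in> ?S" using assms open_vimage_quadric by auto
  have 1: "partial i (\<lambda>x. F (?q x)) y = deriv F (?q y) * (2 * \<kappa> * (y $ i - c $ i))" if "y \<in> ?S" for i y
    using partial_compose(2)[OF quadric_has_derivative smooth_real_on_has_deriv[OF assms(2)]] that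
    by (simp add: partial_quadric)
  have "partial i (partial i (\<lambda>x. F (?q x))) x
     = 4 * \<kappa> * deriv (deriv F) (?q x) * (\<kappa> * (x $ i - c $ i)\<^sup>2) + 2 * \<kappa> * deriv F (?q x)" for i
  proof -
    have "partial i (partial i (\<lambda>x. F (?q x))) x
        = partial i (\<lambda>y. deriv F (?q y) * (2 * \<kappa> * (y $ i - c $ i))) x"
      by (rule partial_cong_open[OF S 1])
    also have "\<dots> = deriv F (?q x) * (2 * \<kappa>)
        + deriv (deriv F) (?q x) * (2 * \<kappa> * (x $ i - c $ i)) * (2 * \<kappa> * (x $ i - c $ i))"
    proof -
      have d: "(deriv F has_real_derivative deriv (deriv F) (?q x)) (at (?q x))"
        using assms by (intro smooth_real_on_has_deriv[OF smooth_real_on_deriv]) auto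
      show ?thesis
        using partial_mult[OF partial_compose(1)[OF quadric_has_derivative d]
            coordinate_has_derivative[of "2 * \<kappa>" i "c $ i" x], of i]
          partial_compose(2)[OF quadric_has_derivative d, of i]
          has_derivative_partial(2)[OF coordinate_has_derivative[of "2 * \<kappa>" i "c $ i" x], of i]
        by (simp add: partial_quadric)
    qed
    finally show ?thesis by (simp add: power2_eq_square algebra_simps)
  qed
  then have "laplacian (\<lambda>x. F (?q x)) x
      = 4 * \<kappa> * deriv (deriv F) (?q x) * (\<kappa> * (\<Sum>i\<in>UNIV. (x $ i - c $ i)\<^sup>2))
        + real CARD('n) * (2 * \<kappa> * deriv F (?q x))"
    by (simp add: laplacian_def sum.distrib sum_distrib_left)
  also have "\<kappa> * (\<Sum>i\<in>UNIV. (x $ i - c $ i)\<^sup>2) = ?q x - \<tau>"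
    by (simp add: quadric_def inner_vec_def power2_eq_square)
  finally show ?thesis by (simp add: radial_op_def algebra_simps)
qed

lemma smooth_real_on_radial_op:
  assumes "open J" "smooth_real_on J F"
  shows "smooth_real_on J (radial_op n \<tau> F)"
proof -
  have "smooth_real_on J (\<lambda>t. (4 * (t - \<tau>)) * deriv (deriv F) t + 2 * n * deriv F t)"
    by (intro smooth_real_on_add smooth_real_on_mult smooth_real_on_diff smooth_real_on_deriv
        smooth_real_on_const smooth_real_on_id assms)
  then show ?thesis by (simp add: radial_op_def)
qed

lemma smooth_real_on_radial_op_pow:
  "open J \<Longrightarrow> smooth_real_on J F \<Longrightarrow> smooth_real_on J ((radial_op n \<tau> ^^ k) F)"
  by (induction k) (auto intro: smooth_real_on_radial_op)

lemma iter_laplacian_radial: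
  fixes c :: "real^'n::finite"
  assumes "open J" "smooth_real_on J F" "quadric \<kappa> c \<tau> x \<in> J"
  shows "iter_laplacian k (\<lambda>x. F (quadric \<kappa> c \<tau> x)) x
    = \<kappa> ^ k * (radial_op (real CARD('n)) \<tau> ^^ k) F (quadric \<kappa> c \<tau> x)"
  using assms(3)
proof (induction k arbitrary: x)
  case (Suc k)
  let ?G = "(radial_op (real CARD('n)) \<tau> ^^ k) F" and ?q = "quadric \<kappa> c \<tau>"
  have S: "open (?q -` J)" "x \<in> ?q -` J" using Suc.prems assms open_vimage_quadric by auto
  have G: "smooth_real_on J ?G" by (rule smooth_real_on_radial_op_pow[OF assms(1,2)])
  have "iter_laplacian (Suc k) (\<lambda>x. F (?q x)) x = laplacian (\<lambda>x. 0 + \<kappa> ^ k * ?G (?q x)) x"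
    unfolding iter_laplacian_Suc by (rule laplacian_cong_open[OF S]) (use Suc.IH in simp)
  also have "\<dots> = laplacian (\<lambda>x. 0) x + \<kappa> ^ k * laplacian (\<lambda>x. ?G (?q x)) x"
    by (rule laplacian_lin[OF S smooth_on_const smooth_on_radial[OF assms(1) G]])
  also have "laplacian (\<lambda>x. 0) x = 0"
    by (simp add: laplacian_def partial_def)
  finally show ?case
    using laplacian_radial[OF assms(1) G Suc.prems] by simp
qed simp

lemma deriv_lin:
  fixes F G :: "real \<Rightarrow> real"
  assumes "smooth_real_on J F" "smooth_real_on J G" "t \<in> J"
  shows "deriv (\<lambda>t. F t + c * G t) t = deriv F t + c * deriv G t"
  by (intro DERIV_imp_deriv DERIV_add DERIV_cmult smooth_real_on_has_deriv[OF _ assms(3)] assms)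

lemma radial_op_eqI:
  assumes "open J" "t \<in> J" "\<And>x. x \<in> J \<Longrightarrow> (F has_real_derivative F' x) (at x)"
    and "(F' has_real_derivative F'') (at t)"
  shows "radial_op n \<tau> F t = 4 * (t - \<tau>) * F'' + 2 * n * F' t"
proof -
  have d: "deriv F x = F' x" if "x \<in> J" for x
    using assms(3)[OF that] by (rule DERIV_imp_deriv)
  have "deriv (deriv F) t = deriv F' t"
    by (rule deriv_cong_open[OF assms(1,2) d])
  then show ?thesis
    using DERIV_imp_deriv[OF assms(4)] d[OF assms(2)] by (simp add: radial_op_def)
qed

lemma radial_op_cong:
  assumes "open J" "t \<in> J" "\<And>x. x \<in> J \<Longrightarrow> F x = G x"
  shows "radial_op n \<tau> F t = radial_op n \<tau> G t"
proof -
  have d: "deriv F x = deriv G x" if "x \<in> J" for x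
    by (rule deriv_cong_open[OF assms(1) that assms(3)])
  have "deriv (deriv F) t = deriv (deriv G) t"
    by (rule deriv_cong_open[OF assms(1,2) d])
  then show ?thesis
    using d[OF assms(2)] by (simp add: radial_op_def)
qed

lemma radial_op_pow_cong:
  assumes "open J" "t \<in> J" "\<And>x. x \<in> J \<Longrightarrow> F x = G x"
  shows "(radial_op n \<tau> ^^ k) F t = (radial_op n \<tau> ^^ k) G t"
  using assms(2)
proof (induction k arbitrary: t)
  case 0
  then show ?case using assms(3) by simp
next
  case (Suc k)
  show ?case
    unfolding funpow.simps o_def by (rule radial_op_cong[OF assms(1) Suc.prems Suc.IH])
qed

lemma radial_op_lin:
  assumes "open J" "t \<in> J" "smooth_real_on J F" "smooth_real_on J G"
  shows "radial_op n \<tau> (\<lambda>t. F t + c * G t) t = radial_op n \<tau> F t + c * radial_op n \<tau> G t"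
proof -
  have "deriv (deriv (\<lambda>t. F t + c * G t)) t = deriv (\<lambda>t. deriv F t + c * deriv G t) t"
    by (rule deriv_cong_open[OF assms(1,2) deriv_lin[OF assms(3,4)]])
  also have "\<dots> = deriv (deriv F) t + c * deriv (deriv G) t"
    by (intro deriv_lin[of J] smooth_real_on_deriv assms)
  finally show ?thesis
    using deriv_lin[OF assms(3,4,2)] by (simp add: radial_op_def algebra_simps)
qed

lemma radial_op_pow_lin:
  assumes "open J" "t \<in> J" "smooth_real_on J F" "smooth_real_on J G"
  shows "(radial_op n \<tau> ^^ k) (\<lambda>t. F t + c * G t) t
    = (radial_op n \<tau> ^^ k) F t + c * (radial_op n \<tau> ^^ k) G t"
  using assms(2)
proof (induction k arbitrary: t)
  case (Suc k)
  have "(radial_op n \<tau> ^^ Suc k) (\<lambda>t. F t + c * G t) t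
      = radial_op n \<tau> (\<lambda>t. (radial_op n \<tau> ^^ k) F t + c * (radial_op n \<tau> ^^ k) G t) t"
    unfolding funpow.simps o_def by (rule radial_op_cong[OF assms(1) Suc.prems Suc.IH])
  also have "\<dots> = (radial_op n \<tau> ^^ Suc k) F t + c * (radial_op n \<tau> ^^ Suc k) G t"
    unfolding funpow.simps o_def
    by (rule radial_op_lin[OF assms(1) Suc.prems]) (intro smooth_real_on_radial_op_pow assms)+
  finally show ?case .
qed simp

lemma radial_op_sum:
  assumes "open J" "t \<in> J" "finite I" "\<And>i. i \<in> I \<Longrightarrow> smooth_real_on J (f i)"
  shows "radial_op n \<tau> (\<lambda>t. \<Sum>i\<in>I. c i * f i t) t = (\<Sum>i\<in>I. c i * radial_op n \<tau> (f i) t)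
    \<and> smooth_real_on J (\<lambda>t. \<Sum>i\<in>I. c i * f i t)"
  using assms(3,4)
proof (induction I rule: finite_induct)
  case empty
  then show ?case by (simp add: radial_op_def smooth_real_on_const)
next
  case (insert i I)
  have "radial_op n \<tau> (\<lambda>t. (\<Sum>i\<in>I. c i * f i t) + c i * f i t) t
      = radial_op n \<tau> (\<lambda>t. \<Sum>i\<in>I. c i * f i t) t + c i * radial_op n \<tau> (f i) t"
    using insert by (intro radial_op_lin[OF assms(1,2)]) auto
  moreover have "smooth_real_on J (\<lambda>t. (\<Sum>i\<in>I. c i * f i t) + c i * f i t)"
    using insert by (intro smooth_real_on_add smooth_real_on_mult smooth_real_on_const assms(1)) auto
  ultimately show ?case using insert by (simp add: add.commute)
qed

text \<open>\<open>\<tau>\<close> will be the width parameter of a bubble, so the bound must not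
  depend on it. The operator is affine in \<open>\<tau>\<close>, and the induction hypothesis
  applies to both coefficients \<open>?G\<close> and \<open>?H\<close>, which are free of
  \<open>\<tau>\<close>.\<close>

lemma radial_op_pow_bounded:
  assumes "open J" "K \<subseteq> J" "compact K" "smooth_real_on J F"
  shows "\<exists>C\<ge>0. \<forall>\<tau>\<in>{0..1}. \<forall>t\<in>K. \<bar>(radial_op n \<tau> ^^ k) F t\<bar> \<le> C"
  using assms(4)
proof (induction k arbitrary: F)
  case 0
  have "compact (F ` K)"
    using compact_continuous_image[OF continuous_on_subset[OF smooth_real_on_continuous[OF 0] assms(2)] assms(3)] .
  then obtain C where "\<forall>y\<in>F ` K. \<bar>y\<bar> \<le> C"
    using compact_imp_bounded bounded_real by blast
  then show ?case by (intro exI[of _ "max C 0"]) (auto simp: le_max_iff_disj)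
next
  case (Suc k)
  let ?G = "radial_op n 0 F" and ?H = "\<lambda>t. 4 * deriv (deriv F) t"
  have sm: "smooth_real_on J ?G" "smooth_real_on J ?H"
    by (intro smooth_real_on_radial_op smooth_real_on_mult smooth_real_on_const
        smooth_real_on_deriv Suc.prems assms(1))+
  obtain C1 C2 where C: "C1 \<ge> 0" "C2 \<ge> 0"
    "\<And>\<tau> t. \<tau> \<in> {0..1} \<Longrightarrow> t \<in> K \<Longrightarrow> \<bar>(radial_op n \<tau> ^^ k) ?G t\<bar> \<le> C1"
    "\<And>\<tau> t. \<tau> \<in> {0..1} \<Longrightarrow> t \<in> K \<Longrightarrow> \<bar>(radial_op n \<tau> ^^ k) ?H t\<bar> \<le> C2"
    using Suc.IH[OF sm(1)] Suc.IH[OF sm(2)] by metis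
  have "\<bar>(radial_op n \<tau> ^^ Suc k) F t\<bar> \<le> C1 + C2" if \<tau>: "\<tau> \<in> {0..1}" and t: "t \<in> K" for \<tau> t
  proof -
    have "radial_op n \<tau> F = (\<lambda>t. ?G t + (- \<tau>) * ?H t)"
      by (simp add: radial_op_def fun_eq_iff algebra_simps)
    then have "(radial_op n \<tau> ^^ Suc k) F t = (radial_op n \<tau> ^^ k) (\<lambda>t. ?G t + (- \<tau>) * ?H t) t"
      by (simp only: funpow_Suc_right o_def)
    also have "\<dots> = (radial_op n \<tau> ^^ k) ?G t + (- \<tau>) * (radial_op n \<tau> ^^ k) ?H t"
      using t assms(2) by (intro radial_op_pow_lin[OF assms(1) _ sm]) auto
    finally have "\<bar>(radial_op n \<tau> ^^ Suc k) F t\<bar>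
        \<le> \<bar>(radial_op n \<tau> ^^ k) ?G t\<bar> + \<bar>\<tau> * (radial_op n \<tau> ^^ k) ?H t\<bar>"
      by linarith
    also have "\<bar>\<tau> * (radial_op n \<tau> ^^ k) ?H t\<bar> \<le> 1 * C2"
      unfolding abs_mult using \<tau> C(4)[OF \<tau> t] by (intro mult_mono) auto
    finally show ?thesis using C(3)[OF \<tau> t] by linarith
  qed
  then show ?case using C(1,2) by (intro exI[of _ "C1 + C2"]) auto
qed

lemma radial_op_powr:
  assumes "t > 0"
  shows "radial_op n \<tau> (\<lambda>t. t powr p) t
    = 2 * p * (n + 2 * p - 2) * t powr (p - 1) - 4 * \<tau> * p * (p - 1) * t powr (p - 2)"
proof -
  have "radial_op n \<tau> (\<lambda>t. t powr p) t
      = 4 * (t - \<tau>) * (p * ((p - 1) * t powr (p - 2))) + 2 * n * (p * t powr (p - 1))"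
  proof (rule radial_op_eqI[of "{0<..}"])
    show "((\<lambda>t. t powr p) has_real_derivative p * x powr (p - 1)) (at x)" if "x \<in> {0<..}" for x
      using that by (auto intro: has_real_derivative_powr)
    show "((\<lambda>x. p * x powr (p - 1)) has_real_derivative p * ((p - 1) * t powr (p - 2))) (at t)"
      using has_real_derivative_powr[OF assms, of "p - 1"] by (intro DERIV_cmult) simp
  qed (use assms in auto)
  moreover have "t powr (p - 1) = t * t powr (p - 2)"
    using assms powr_mult_base[of t "p - 2"] by simp
  ultimately show ?thesis by (simp only:) (simp add: algebra_simps)
qed

section \<open>The bubble\<close>

text \<open>Coefficients in the expansion of the iterates of \<open>radial_op\<close> on a power: a
  term of index \<open>i\<close> feeds the indices \<open>i\<close> and \<open>Suc i\<close> of the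
  next iterate.\<close>

fun bubble_coeff :: "real \<Rightarrow> nat \<Rightarrow> nat \<Rightarrow> real" where
  "bubble_coeff m 0 i = (if i = 0 then 1 else 0)"
| "bubble_coeff m (Suc p) 0 = (m - 1 - real p) * bubble_coeff m p 0"
| "bubble_coeff m (Suc p) (Suc i) =
    (m - 2 - real p - real i) * bubble_coeff m p (Suc i) + bubble_coeff m p i"

lemma binomial_step: "real (Suc i) * real (p choose Suc i) = (real p - real i) * real (p choose i)"
proof (cases "i \<le> p")
  case True
  have "Suc i * (p choose Suc i) = (p - i) * (p choose i)"
    using binomial_absorption[of i p] binomial_absorb_comp[of p i] by simp
  then show ?thesis using True by (metis of_nat_diff of_nat_mult)
qed (simp add: binomial_eq_0)

text \<open>The closed form reveals which coefficients vanish: the product contains a zero factor as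
  soon as \<open>m\<close> is an integer in \<open>{i<..p}\<close>.\<close>

lemma bubble_coeff_eq:
  "bubble_coeff m p i = real (p choose i) * (\<Prod>k\<in>{i<..p}. m - real k)"
proof (induction p arbitrary: i)
  case 0
  then show ?case by (cases i) auto
next
  case (Suc p)
  have top: "(\<Prod>k\<in>{j<..Suc p}. m - real k) = (m - real (Suc p)) * (\<Prod>k\<in>{j<..p}. m - real k)"
    if "j \<le> p" for j
  proof -
    have "{j<..Suc p} = insert (Suc p) {j<..p}" using that by auto
    then show ?thesis by simp
  qed
  show ?case
  proof (cases i)
    case 0
    then show ?thesis using top[of 0] by (simp add: Suc.IH algebra_simps)
  next
    case (Suc j)
    consider "Suc j \<le> p" | "j = p" | "j > p" by linarith
    then show ?thesis
    proof cases
      case 1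
      let ?P = "\<Prod>k\<in>{Suc j<..p}. m - real k"
      have "{j<..p} = insert (Suc j) {Suc j<..p}" using 1 by auto
      then have pr: "(\<Prod>k\<in>{j<..p}. m - real k) = (m - real (Suc j)) * ?P" by simp
      have "bubble_coeff m (Suc p) i
          = ((m - 2 - real p - real j) * real (p choose Suc j)
            + real (p choose j) * (m - real (Suc j))) * ?P"
        unfolding Suc bubble_coeff.simps Suc.IH pr by (simp only: algebra_simps)
      \<comment> \<open>Pascal's rule on the right; the remaining difference of the two sides is
        exactly \<open>binomial_step\<close>.\<close>
      also have "(m - 2 - real p - real j) * real (p choose Suc j) + real (p choose j) * (m - real (Suc j))
          = real (Suc p choose Suc j) * (m - real (Suc p))"
        using binomial_step[of j p] by (simp add: algebra_simps)
      finally show ?thesis using top[OF 1] unfolding Suc by simp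
    next
      case 2
      then show ?thesis unfolding Suc by (simp add: Suc.IH)
    next
      case 3
      then show ?thesis unfolding Suc by (simp add: Suc.IH binomial_eq_0)
    qed
  qed
qed

text \<open>\<open>radial_op_powr\<close> splits each power into one with exponent lowered by 1 and
  one, carrying \<open>\<tau>\<close>, with exponent lowered by 2; the factors
  \<open>s + real (p + i)\<close> accumulate in the rising factorial. Here \<open>m\<close> is an
  arbitrary real number.\<close>

lemma radial_op_pow_bubble_expansion:
  assumes "n = 2 * s + 2 * m" "t > 0"
  shows "(radial_op n \<tau> ^^ p) (\<lambda>t. t powr - s) t
    = (-4) ^ p * (\<Sum>i\<le>p. bubble_coeff m p i * \<tau> ^ i * pochhammer s (p + i) * t powr (- s - real p - real i))"
  using assms(2)
proof (induction p arbitrary: t)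
  case 0
  then show ?case by simp
next
  case (Suc p)
  let ?c = "\<lambda>i. (-4) ^ p * (bubble_coeff m p i * \<tau> ^ i * pochhammer s (p + i))"
  let ?T = "\<lambda>i. \<tau> ^ i * pochhammer s (Suc p + i) * t powr (- s - real (Suc p) - real i)"
  have step: "radial_op n \<tau> (\<lambda>t. t powr (- s - real p - real i)) t
      = -4 * ((s + real (p + i)) * (m - 1 - real p - real i) * t powr (- s - real (Suc p) - real i)
        + \<tau> * (s + real (p + i)) * (s + real (p + i) + 1) * t powr (- s - real (Suc p) - real (Suc i)))" for i
    unfolding radial_op_powr[OF Suc.prems] assms(1) by (simp add: algebra_simps)
  have coeff: "?c i * radial_op n \<tau> (\<lambda>t. t powr (- s - real p - real i)) t
      = (-4) ^ Suc p * ((m - 1 - real p - real i) * bubble_coeff m p i * ?T i + bubble_coeff m p i * ?T (Suc i))" for i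
    unfolding step by (simp add: pochhammer_Suc) (simp add: algebra_simps)
  have "(radial_op n \<tau> ^^ Suc p) (\<lambda>t. t powr - s) t
      = radial_op n \<tau> (\<lambda>t. \<Sum>i\<le>p. ?c i * t powr (- s - real p - real i)) t"
    unfolding funpow.simps o_def
    by (rule radial_op_cong[of "{0<..}"]) (use Suc in \<open>auto simp: sum_distrib_left mult.assoc\<close>)
  also have "\<dots> = (\<Sum>i\<le>p. ?c i * radial_op n \<tau> (\<lambda>t. t powr (- s - real p - real i)) t)"
    using Suc.prems by (intro conjunct1[OF radial_op_sum[of "{0<..}"]]) (auto intro: smooth_real_on_powr)
  also have "\<dots> = (-4) ^ Suc p * ((\<Sum>i\<le>p. (m - 1 - real p - real i) * bubble_coeff m p i * ?T i)
      + (\<Sum>i\<le>p. bubble_coeff m p i * ?T (Suc i)))"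
    unfolding coeff by (simp only: sum_distrib_left sum.distrib distrib_left)
  \<comment> \<open>The added summand \<open>i = Suc p\<close> is zero because
    \<open>p choose Suc p = 0\<close>; it makes room for the index shift.\<close>
  also have "(\<Sum>i\<le>p. (m - 1 - real p - real i) * bubble_coeff m p i * ?T i)
      = (\<Sum>i\<le>Suc p. (m - 1 - real p - real i) * bubble_coeff m p i * ?T i)"
    by (simp add: bubble_coeff_eq)
  also have "\<dots> = (m - 1 - real p) * bubble_coeff m p 0 * ?T 0
      + (\<Sum>i\<le>p. (m - 2 - real p - real i) * bubble_coeff m p (Suc i) * ?T (Suc i))"
    by (subst sum.atMost_Suc_shift) (simp add: algebra_simps)
  also have "\<dots> + (\<Sum>i\<le>p. bubble_coeff m p i * ?T (Suc i))
      = bubble_coeff m (Suc p) 0 * ?T 0 + (\<Sum>i\<le>p. bubble_coeff m (Suc p) (Suc i) * ?T (Suc i))"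
    by (simp add: sum.distrib[symmetric] algebra_simps)
  also have "\<dots> = (\<Sum>i\<le>Suc p. bubble_coeff m (Suc p) i * ?T i)"
    by (rule sum.atMost_Suc_shift[symmetric])
  finally show ?case by (simp only: mult.assoc)
qed

text \<open>In the critical dimension \<open>n = 2 s + 2 m\<close> all but one coefficient vanish after \<open>m\<close> steps:
  \<open>(|x|\<^sup>2 + \<tau>) powr (- s)\<close> is the conformally invariant bubble of \<open>(- \<Delta>)\<^sup>m\<close>.\<close>
lemma radial_op_pow_bubble:
  assumes "n = 2 * s + 2 * real m" "t > 0"
  shows "(radial_op n \<tau> ^^ m) (\<lambda>t. t powr - s) t
    = (-4) ^ m * \<tau> ^ m * pochhammer s (2 * m) * t powr (- s - 2 * real m)"
proof -
  \<comment> \<open>The product in the closed form runs over \<open>{i<..m}\<close> and so contains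
    the zero factor \<open>k = m\<close>.\<close>
  have "bubble_coeff (real m) m i = 0" if "i < m" for i
    using that by (auto simp: bubble_coeff_eq)
  then have "(\<Sum>i\<le>m. bubble_coeff (real m) m i * \<tau> ^ i * pochhammer s (m + i) * t powr (- s - real m - real i))
      = bubble_coeff (real m) m m * \<tau> ^ m * pochhammer s (m + m) * t powr (- s - real m - real m)"
    by (subst sum.mono_neutral_right[of _ "{m}"]) auto
  moreover have "bubble_coeff (real m) m m = 1"
    by (simp add: bubble_coeff_eq)
  moreover have "- s - real m - real m = - s - 2 * real m" by simp
  ultimately show ?thesis
    unfolding radial_op_pow_bubble_expansion[OF assms] mult_2[of m] by (simp only: mult_1 mult.assoc)
qed

section \<open>The radial equation\<close>

text \<open>The antiderivative is the integral from \<open>x\<close> to \<open>B\<close>, over an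
  empty or degenerate interval once \<open>x \<ge> B\<close>. Near a given point it is a constant
  minus an integral with fixed lower end, whose derivative is known.\<close>

lemma antiderivative_vanishing:
  fixes f :: "real \<Rightarrow> real"
  assumes "B > 0" "continuous_on {0<..} f" "\<And>x. x \<ge> B \<Longrightarrow> f x = 0"
  obtains F where "\<And>x. x > 0 \<Longrightarrow> (F has_real_derivative - f x) (at x)" "\<And>x. x \<ge> B \<Longrightarrow> F x = 0"
proof
  define F where "F = (\<lambda>x. integral {x..B} f)"
  show "F x = 0" if "x \<ge> B" for x
    using that by (cases "x = B") (auto simp: F_def)
  show "(F has_real_derivative - f x) (at x)" if "x > 0" for x
  proof -
    \<comment> \<open>\<open>b\<close> lies beyond both \<open>B\<close> and \<open>x\<close>, so
      extending the integral from \<open>B\<close> to \<open>b\<close> only adds zeros of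
      \<open>f\<close>; \<open>a\<close> keeps a neighbourhood of \<open>x\<close> inside the
      domain.\<close>
    define a b where "a = x / 2" and "b = max x B + 1"
    have ab: "0 < a" "a < x" "x < b" "B < b" using that by (auto simp: a_def b_def)
    have cont: "continuous_on {a..b} f"
      using ab(1) by (intro continuous_on_subset[OF assms(2)]) auto
    then have int: "f integrable_on {u..v}" if "a \<le> u" "v \<le> b" for u v
      using that by (intro integrable_continuous_interval) (auto intro: continuous_on_subset)
    have zero: "integral {u..b} f = 0" if "u \<ge> B" for u
      using that assms(3) integral_cong[of "{u..b}" f "\<lambda>_. 0"] by simp
    have F_eq: "integral {a..b} f - integral {a..y} f = F y" if y: "y \<in> {a<..<b}" for y
    proof -
      have "integral {a..y} f + integral {y..b} f = integral {a..b} f"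
        using y by (intro Henstock_Kurzweil_Integration.integral_combine int) auto
      moreover have "integral {y..b} f = F y"
      proof (cases "y \<le> B")
        case True
        then have "integral {y..B} f + integral {B..b} f = integral {y..b} f"
          using y ab by (intro Henstock_Kurzweil_Integration.integral_combine int) auto
        then show ?thesis using zero[of B] by (simp add: F_def)
      next
        case False
        then show ?thesis using zero[of y] by (simp add: F_def)
      qed
      ultimately show ?thesis by linarith
    qed
    have "((\<lambda>y. integral {a..y} f) has_real_derivative f x) (at x within {a..b})"
      using ab by (intro integral_has_real_derivative cont) auto
    then have "((\<lambda>y. integral {a..y} f) has_real_derivative f x) (at x)"
      using ab by (simp add: at_within_Icc_at)
    then have "((\<lambda>y. integral {a..b} f - integral {a..y} f) has_real_derivative 0 - f x) (at x)"
      by (intro DERIV_diff DERIV_const)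
    then show ?thesis
      using has_field_derivative_transform_within_open[of _ _ x "{a<..<b}" F] ab F_eq by auto
  qed
qed

text \<open>The comparison principle behind the one-sided bounds below: information is carried from
  \<open>B\<close> leftwards towards the singularity.\<close>

lemma nonneg_of_deriv_nonpos:
  fixes F :: "real \<Rightarrow> real"
  assumes "\<And>x. x > 0 \<Longrightarrow> (F has_real_derivative f x) (at x)" "\<And>x. x > 0 \<Longrightarrow> f x \<le> 0"
    and "F B \<ge> 0" "0 < t" "t \<le> B"
  shows "F t \<ge> 0"
proof -
  have "F B \<le> F t"
  proof (rule DERIV_nonpos_imp_nonincreasing[OF assms(5)])
    fix x assume "t \<le> x"
    then have "x > 0" using assms(4) by linarith
    then show "\<exists>y. (F has_real_derivative y) (at x) \<and> y \<le> 0" using assms(1,2) by blast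
  qed
  then show ?thesis using assms(3) by linarith
qed

text \<open>The radial equation reads \<open>4 t powr (1 - n/2) * (t powr (n/2) * V')' = G\<close>;
  it is integrated twice starting from beyond the support of \<open>G\<close>.\<close>
lemma radial_op_solution:
  assumes n: "n > 2" and B: "B > 0" and G: "smooth_real_on {0<..} G" "\<And>t. t \<ge> B \<Longrightarrow> G t = 0"
    and G_bd: "\<And>t. t > 0 \<Longrightarrow> 0 \<le> G t \<and> G t \<le> C * t powr (1 - n / 2)"
  obtains V C' where "smooth_real_on {0<..} V" "\<And>t. t \<ge> B \<Longrightarrow> V t = 0"
    "\<And>t. t > 0 \<Longrightarrow> 0 \<le> V t \<and> V t \<le> C' * t powr (1 - n / 2)"
    "\<And>t. t > 0 \<Longrightarrow> radial_op n 0 V t = G t"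
proof -
  \<comment> \<open>With \<open>I = - t powr (n / 2) * V'\<close> the equation becomes
    \<open>I' = - f1\<close>. The growth bound on \<open>G\<close> is exactly what makes
    \<open>f1\<close> bounded.\<close>
  define f1 where "f1 = (\<lambda>t. t powr (n / 2 - 1) * (1 / 4 * G t))"
  define c where "c = C / 4"
  have f1_smooth: "smooth_real_on {0<..} f1"
    unfolding f1_def
    by (intro smooth_real_on_mult smooth_real_on_powr smooth_real_on_const G open_greaterThan)
  have f1_bd: "0 \<le> f1 t \<and> f1 t \<le> c" if "t > 0" for t
  proof -
    have "t powr (n / 2 - 1) * (1 / 4 * G t) \<le> t powr (n / 2 - 1) * (1 / 4 * (C * t powr (1 - n / 2)))"
      using G_bd[OF that] by (intro mult_left_mono) auto
    also have "\<dots> = c * t powr ((n / 2 - 1) + (1 - n / 2))"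
      unfolding powr_add c_def by simp
    finally show ?thesis using G_bd[OF that] that by (simp add: f1_def)
  qed
  have c: "c \<ge> 0" using f1_bd[of 1] by simp
  obtain I where I: "\<And>x. x > 0 \<Longrightarrow> (I has_real_derivative - f1 x) (at x)" "\<And>x. x \<ge> B \<Longrightarrow> I x = 0"
    by (rule antiderivative_vanishing[OF B smooth_real_on_continuous[OF f1_smooth]])
      (auto simp: f1_def G(2))
  have I_smooth: "smooth_real_on {0<..} I"
  proof (rule smooth_real_onI)
    show "smooth_real_on {0<..} (\<lambda>t. 0 - f1 t)"
      by (intro smooth_real_on_diff smooth_real_on_const f1_smooth open_greaterThan)
  qed (use I(1) in auto)
  have I_nonneg: "0 \<le> I t" if "t > 0" for t
    using nonneg_of_deriv_nonpos[of I "\<lambda>t. - f1 t" B t] I f1_bd that by (cases "t \<le> B") auto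
  have I_le: "I t \<le> c * B" if "t > 0" for t
  proof (cases "t \<le> B")
    case True
    have "0 \<le> c * (B - t) - I t"
    proof (rule nonneg_of_deriv_nonpos[where F = "\<lambda>x. c * (B - x) - I x" and B = B and f = "\<lambda>t. f1 t - c"])
      show "((\<lambda>x. c * (B - x) - I x) has_real_derivative f1 x - c) (at x)" if "x > 0" for x
        using I(1)[OF that] by (auto intro!: derivative_eq_intros)
    qed (use f1_bd I(2)[of B] True that in auto)
    moreover have "c * (B - t) \<le> c * B" using c that by (intro mult_left_mono) auto
    ultimately show ?thesis by linarith
  next
    case False
    then show ?thesis using I(2)[of t] c B by simp
  qed
  \<comment> \<open>\<open>- f2\<close> is the derivative that \<open>V\<close> must have, recovered
    from \<open>I\<close>.\<close>
  define f2 where "f2 = (\<lambda>t. t powr (- n / 2) * I t)"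
  have f2_smooth: "smooth_real_on {0<..} f2"
    unfolding f2_def by (intro smooth_real_on_mult smooth_real_on_powr I_smooth open_greaterThan)
  obtain V where V: "\<And>x. x > 0 \<Longrightarrow> (V has_real_derivative - f2 x) (at x)" "\<And>x. x \<ge> B \<Longrightarrow> V x = 0"
    by (rule antiderivative_vanishing[OF B smooth_real_on_continuous[OF f2_smooth]])
      (auto simp: f2_def I(2))
  have V_smooth: "smooth_real_on {0<..} V"
  proof (rule smooth_real_onI)
    show "smooth_real_on {0<..} (\<lambda>t. 0 - f2 t)"
      by (intro smooth_real_on_diff smooth_real_on_const f2_smooth open_greaterThan)
  qed (use V(1) in auto)
  have V_nonneg: "0 \<le> V t" if "t > 0" for t
    using nonneg_of_deriv_nonpos[of V "\<lambda>t. - f2 t" B t] V I_nonneg that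
    by (cases "t \<le> B") (auto simp: f2_def)
  \<comment> \<open>Chosen so that \<open>K * t powr (1 - n / 2)\<close> has derivative
    \<open>- c * B * t powr (- n / 2)\<close>, which bounds \<open>V'\<close> from below.\<close>
  define K where "K = c * B / (n / 2 - 1)"
  have K: "K \<ge> 0" "K * (n / 2 - 1) = c * B" using c B n by (auto simp: K_def)
  have V_le: "V t \<le> K * t powr (1 - n / 2)" if "t > 0" for t
  proof (cases "t \<le> B")
    case True
    have "0 \<le> K * t powr (1 - n / 2) - V t"
    proof (rule nonneg_of_deriv_nonpos[where F = "\<lambda>x. K * x powr (1 - n / 2) - V x" and B = B
          and f = "\<lambda>t. t powr (- n / 2) * (I t - c * B)"])
      show "((\<lambda>x. K * x powr (1 - n / 2) - V x) has_real_derivative x powr (- n / 2) * (I x - c * B)) (at x)"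
        if "x > 0" for x
      proof -
        have "((\<lambda>x. K * x powr (1 - n / 2) - V x) has_real_derivative
            K * ((1 - n / 2) * x powr (1 - n / 2 - 1)) - - f2 x) (at x)"
          by (intro DERIV_diff DERIV_cmult has_real_derivative_powr that V(1))
        moreover have "K * ((1 - n / 2) * x powr (1 - n / 2 - 1)) - - f2 x
            = x powr (- n / 2) * (I x - K * (n / 2 - 1))"
          by (simp add: f2_def algebra_simps)
        ultimately show ?thesis unfolding K(2) by simp
      qed
      show "x powr (- n / 2) * (I x - c * B) \<le> 0" if "x > 0" for x
        using I_le[OF that] by (intro mult_nonneg_nonpos) auto
    qed (use K V(2)[of B] True that in auto)
    then show ?thesis by linarith
  next
    case False
    then show ?thesis using V(2)[of t] K by simp
  qed
  have "radial_op n 0 V t = G t" if t: "t > 0" for t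
  proof -
    have d: "((\<lambda>t. - f2 t) has_real_derivative
        - ((- n / 2) * t powr (- n / 2 - 1) * I t + (- f1 t) * t powr (- n / 2))) (at t)"
      unfolding f2_def by (intro DERIV_minus DERIV_mult has_real_derivative_powr t I(1))
    have e1: "t powr (- n / 2) = t * t powr (- n / 2 - 1)"
      using t powr_mult_base[of t "- n / 2 - 1"] by simp
    have e2: "t * (t powr (- n / 2) * t powr (n / 2 - 1)) = 1"
    proof -
      have "t powr (- n / 2) * t powr (n / 2 - 1) = t powr (- 1)" by (simp flip: powr_add)
      then show ?thesis using t by (simp add: powr_minus)
    qed
    have "radial_op n 0 V t = 4 * (t - 0) *
        - ((- n / 2) * t powr (- n / 2 - 1) * I t + (- f1 t) * t powr (- n / 2)) + 2 * n * - f2 t"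
      by (rule radial_op_eqI[of "{0<..}", OF _ _ V(1) d]) (use t in auto)
    also have "\<dots> = 4 * t * f1 t * t powr (- n / 2)"
      unfolding f2_def e1 by (simp add: algebra_simps)
    also have "\<dots> = (t * (t powr (- n / 2) * t powr (n / 2 - 1))) * G t"
      by (simp add: f1_def)
    finally show ?thesis unfolding e2 by simp
  qed
  with V_smooth V(2) V_nonneg V_le show ?thesis by (intro that[of V K]) auto
qed

text \<open>One solution of the radial equation inherits everything required of the right-hand side:
  smoothness, support, sign and growth at most that of the fundamental profile
  \<open>t powr (1 - n / 2)\<close>. It can therefore serve as data for the next step.\<close>

lemma radial_op_pow_solution:
  assumes "n > 2" "B > 0" "smooth_real_on {0<..} G" "\<And>t. t \<ge> B \<Longrightarrow> G t = 0"
    and "\<And>t. t > 0 \<Longrightarrow> 0 \<le> G t \<and> G t \<le> C * t powr (1 - n / 2)"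
  shows "\<exists>V C'. smooth_real_on {0<..} V \<and> (\<forall>t\<ge>B. V t = 0) \<and>
    (\<forall>t>0. 0 \<le> V t \<and> V t \<le> C' * t powr (1 - n / 2)) \<and>
    (\<forall>t>0. (radial_op n 0 ^^ k) V t = G t)"
proof (induction k)
  case 0
  show ?case using assms by (intro exI[of _ G] exI[of _ C]) auto
next
  case (Suc k)
  then obtain W C1 where W: "smooth_real_on {0<..} W" "\<And>t. t \<ge> B \<Longrightarrow> W t = 0"
    "\<And>t. t > 0 \<Longrightarrow> 0 \<le> W t \<and> W t \<le> C1 * t powr (1 - n / 2)"
    "\<And>t. t > 0 \<Longrightarrow> (radial_op n 0 ^^ k) W t = G t"
    by blast
  obtain V C2 where V: "smooth_real_on {0<..} V" "\<And>t. t \<ge> B \<Longrightarrow> V t = 0"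
    "\<And>t. t > 0 \<Longrightarrow> 0 \<le> V t \<and> V t \<le> C2 * t powr (1 - n / 2)"
    "\<And>t. t > 0 \<Longrightarrow> radial_op n 0 V t = W t"
    using radial_op_solution[OF assms(1,2) W(1,2,3)] by blast
  have "(radial_op n 0 ^^ Suc k) V t = G t" if "t > 0" for t
  proof -
    have "(radial_op n 0 ^^ k) (radial_op n 0 V) t = (radial_op n 0 ^^ k) W t"
      by (rule radial_op_pow_cong[of "{0<..}"]) (use that V(4) in auto)
    then show ?thesis using W(4)[OF that] by (simp only: funpow_Suc_right o_def)
  qed
  with V show ?case by blast
qed

section \<open>The truncated bubble profile and its compensator\<close>

lemma flat_0_le_1: "0 \<le> flat 0 t" "flat 0 t \<le> 1"
  by (auto simp: flat_def)

text \<open>A quotient of flat functions; as \<open>a < b\<close>, the two terms of the denominator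
  never vanish together. The reciprocal is written with \<open>powr\<close> so that
  \<open>smooth_real_on_powr\<close> applies.\<close>

lemma cutoff_exists:
  fixes a b :: real
  assumes "a < b"
  obtains \<eta> where "smooth_real_on UNIV \<eta>" "\<And>t. t \<le> a \<Longrightarrow> \<eta> t = 1" "\<And>t. t \<ge> b \<Longrightarrow> \<eta> t = 0"
    "\<And>t. 0 \<le> \<eta> t"
proof
  let ?d = "\<lambda>t. flat 0 (b - t) + flat 0 (t - a)"
  let ?\<eta> = "\<lambda>t. flat 0 (b - t) * ?d t powr (- 1)"
  have d: "?d t > 0" for t
    using assms flat_0_le_1[of "b - t"] flat_0_le_1[of "t - a"]
    by (cases "t < b") (auto simp: flat_def intro!: add_pos_nonneg)
  have sm: "smooth_real_on UNIV (\<lambda>t. flat 0 (b - t))" "smooth_real_on UNIV ?d"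
    by (intro smooth_real_on_add smooth_real_on_flat_compose smooth_real_on_diff
        smooth_real_on_const smooth_real_on_id open_UNIV)+
  show "smooth_real_on UNIV ?\<eta>"
    using d by (intro smooth_real_on_mult sm open_UNIV
        smooth_real_on_compose[OF open_UNIV _ sm(2) smooth_real_on_powr]) auto
  show "?\<eta> t = 1" if "t \<le> a" for t
    using that assms d[of t] by (simp add: flat_def powr_minus)
  show "?\<eta> t = 0" if "t \<ge> b" for t
    using that by (simp add: flat_def)
  show "0 \<le> ?\<eta> t" for t
    using flat_0_le_1 by simp
qed

text \<open>The profile is independent of \<open>\<tau>\<close>: the width enters only through the
  operator and the argument, so one \<open>\<Psi>\<close> with one pair of constants serves every
  piece. \<open>C1\<close> bounds the error made in the cut-off zone.\<close>

locale truncated_bubble =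
  fixes m :: nat and n s :: real and \<Psi> :: "real \<Rightarrow> real" and C0 C1 :: real
  assumes Psi: "smooth_real_on {0<..} \<Psi>" "\<And>t. t > 0 \<Longrightarrow> 0 \<le> \<Psi> t"
      "\<And>t. 0 < t \<Longrightarrow> t \<le> 1/16 \<Longrightarrow> \<Psi> t = t powr - s"
      "\<And>t. 1/8 < t \<Longrightarrow> \<Psi> t = 0"
    and C01: "C0 > 0" "C1 \<ge> 0"
    and op_Psi: "\<And>\<tau> t. 0 < t \<Longrightarrow> t < 1/16 \<Longrightarrow>
        (radial_op n \<tau> ^^ m) \<Psi> t = (-1) ^ m * C0 * \<tau> ^ m * t powr (- s - 2 * real m)"
      "\<And>\<tau> t. 0 \<le> \<tau> \<Longrightarrow> \<tau> \<le> 1 \<Longrightarrow> 1/16 \<le> t \<Longrightarrow> t \<le> 1/8 \<Longrightarrow> \<bar>(radial_op n \<tau> ^^ m) \<Psi> t\<bar> \<le> C1"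
      "\<And>\<tau> t. 1/8 < t \<Longrightarrow> (radial_op n \<tau> ^^ m) \<Psi> t = 0"

lemma truncated_bubble_exists:
  fixes n s :: real and m :: nat
  assumes n: "n = 2 * s + 2 * real m" and "s > 0"
  obtains \<Psi> C0 C1 where "truncated_bubble m n s \<Psi> C0 C1"
proof -
  obtain \<eta> where \<eta>: "smooth_real_on UNIV \<eta>" "\<And>t. t \<le> 1/16 \<Longrightarrow> \<eta> t = 1"
    "\<And>t. t \<ge> 1/8 \<Longrightarrow> \<eta> t = 0" "\<And>t. 0 \<le> \<eta> t"
    using cutoff_exists[of "1/16" "1/8"] by auto
  define \<Psi> where "\<Psi> = (\<lambda>t. \<eta> t * t powr - s)"
  have sm: "smooth_real_on {0<..} \<Psi>"
    unfolding \<Psi>_def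
    by (intro smooth_real_on_mult smooth_real_on_powr smooth_real_on_subset[OF \<eta>(1)]) auto
  have "{1/16..1/8::real} \<subseteq> {0<..}" by force
  then obtain C1 where C1: "C1 \<ge> 0" "\<forall>\<tau>\<in>{0..1}. \<forall>t\<in>{1/16..1/8}. \<bar>(radial_op n \<tau> ^^ m) \<Psi> t\<bar> \<le> C1"
    using radial_op_pow_bounded[OF _ _ _ sm, where K = "{1/16..1/8}" and n = n and k = m] by auto
  have "(radial_op n \<tau> ^^ m) \<Psi> t = (-1) ^ m * (4 ^ m * pochhammer s (2 * m)) * \<tau> ^ m * t powr (- s - 2 * real m)"
    if "0 < t" "t < 1/16" for \<tau> t
  proof -
    have "(radial_op n \<tau> ^^ m) \<Psi> t = (radial_op n \<tau> ^^ m) (\<lambda>t. t powr - s) t"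
      by (rule radial_op_pow_cong[of "{0<..<1/16}"]) (use that \<eta>(2) in \<open>auto simp: \<Psi>_def\<close>)
    also have "(-4::real) ^ m = (-1) ^ m * 4 ^ m"
      by (simp flip: power_mult_distrib)
    ultimately show ?thesis
      using radial_op_pow_bubble[OF n that(1), of \<tau>] by (simp add: mult_ac)
  qed
  moreover have "(radial_op n \<tau> ^^ m) \<Psi> t = 0" if "1/8 < t" for \<tau> t
  proof -
    have "(radial_op n \<tau> ^^ m) \<Psi> t = (radial_op n \<tau> ^^ m) (\<lambda>t. 0) t"
      by (rule radial_op_pow_cong[of "{1/8<..}"]) (use that \<eta>(3) in \<open>auto simp: \<Psi>_def\<close>)
    also have "(radial_op n \<tau> ^^ m) (\<lambda>t. 0) = (\<lambda>t. 0)"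
      by (induction m) (auto simp: radial_op_def)
    finally show ?thesis .
  qed
  moreover have "4 ^ m * pochhammer s (2 * m) > 0"
    using assms(2) by (simp add: pochhammer_pos)
  ultimately have "truncated_bubble m n s \<Psi> (4 ^ m * pochhammer s (2 * m)) C1"
    using sm C1 \<eta> by unfold_locales (auto simp: \<Psi>_def)
  then show ?thesis by (rule that)
qed

text \<open>This profile is centred at the origin, hence \<open>\<tau> = 0\<close> in the operator.
  The interval from 1/4 to 4 is chosen to contain all values of
  \<open>|x|\<^sup>2 / R\<^sup>2\<close> on the support of a bubble.\<close>

locale compensator =
  fixes m :: nat and n :: real and V g :: "real \<Rightarrow> real" and C2 c :: real
  assumes V: "smooth_real_on {0<..} V" "\<And>t. t \<ge> 8 \<Longrightarrow> V t = 0"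
      "\<And>t. t > 0 \<Longrightarrow> V t \<le> C2 * t powr (1 - n / 2)" "C2 \<ge> 0"
      "\<And>t. t > 0 \<Longrightarrow> (radial_op n 0 ^^ m) V t = g t"
    and g: "\<And>t. 0 \<le> g t" "\<And>t. g t \<le> 1" "c > 0" "\<And>t. 1/4 \<le> t \<Longrightarrow> t \<le> 4 \<Longrightarrow> c \<le> g t"
      "\<And>t. t \<le> 1/8 \<Longrightarrow> g t = 0" "\<And>t. t \<ge> 8 \<Longrightarrow> g t = 0"

lemma compensator_exists:
  assumes "n > 2"
  obtains V g C2 c where "compensator m n V g C2 c"
proof -
  define g where "g = (\<lambda>t. flat 0 (t - 1/8) * flat 0 (8 - t))"
  have "smooth_real_on {0<..} g"
    unfolding g_def by (intro smooth_real_on_mult smooth_real_on_flat_compose smooth_real_on_diff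
        smooth_real_on_const smooth_real_on_id open_greaterThan)
  moreover have g01: "0 \<le> g t \<and> g t \<le> 1" for t
    unfolding g_def using flat_0_le_1[of "t - 1/8"] flat_0_le_1[of "8 - t"]
    by (auto intro: mult_le_one)
  moreover have g8: "g t = 0" if "t \<ge> 8" for t
    using that by (simp add: g_def flat_def)
  \<comment> \<open>A function bounded by 1 and supported in \<open>t \<le> 8\<close> lies below the
    fundamental profile, since \<open>(8 / t) powr (n / 2 - 1) \<ge> 1\<close> there. This bound
    starts the iterated solution.\<close>
  moreover have "g t \<le> 8 powr (n / 2 - 1) * t powr (1 - n / 2)" if "t > 0" for t
  proof (cases "t \<ge> 8")
    case True
    then show ?thesis using g8 by simp
  next
    case False
    have "8 powr (n / 2 - 1) * t powr (1 - n / 2) = (8 / t) powr (n / 2 - 1)"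
    proof -
      have "1 - n / 2 = - (n / 2 - 1)" by simp
      then show ?thesis
        using that by (simp only: powr_minus powr_divide divide_inverse[of "_ powr _"])
    qed
    moreover have "1 \<le> (8 / t) powr (n / 2 - 1)"
      using that False assms by (intro ge_one_powr_ge_zero) auto
    ultimately show ?thesis using g01[of t] by linarith
  qed
  ultimately obtain V C2 where V: "smooth_real_on {0<..} V" "\<And>t. t \<ge> 8 \<Longrightarrow> V t = 0"
    "\<And>t. t > 0 \<Longrightarrow> 0 \<le> V t \<and> V t \<le> C2 * t powr (1 - n / 2)"
    "\<And>t. t > 0 \<Longrightarrow> (radial_op n 0 ^^ m) V t = g t"
    using radial_op_pow_solution[OF assms, of 8 g "8 powr (n / 2 - 1)" m] by auto
  \<comment> \<open>For these \<open>t\<close> the arguments of the two flat factors are at least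
    1/8 and 4.\<close>
  have "exp (- 8) * exp (- 1) \<le> g t" if "1/4 \<le> t" "t \<le> 4" for t
  proof -
    have "1 / (t - 1/8) \<le> 8" "1 / (8 - t) \<le> 1" using that by (auto simp: field_simps)
    then show ?thesis
      using that unfolding g_def flat_def by (auto intro!: mult_mono)
  qed
  moreover have "g t = 0" if "t \<le> 1/8" for t
    using that by (simp add: g_def flat_def)
  moreover have "C2 \<ge> 0" using V(3)[of 1] by simp
  ultimately have "compensator m n V g C2 (exp (- 8) * exp (- 1))"
    using V g01 g8 by unfold_locales auto
  then show ?thesis by (rule that)
qed

section \<open>Superposition of bubbles\<close>

text \<open>Each summand is at most its base times \<open>(a + b) powr (p - 1)\<close>. This later
  recombines the regular part and the bubble part of a source after each has been estimated
  separately.\<close>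

lemma powr_superadditive:
  fixes a b :: real
  assumes "a \<ge> 0" "b \<ge> 0" "p \<ge> 1"
  shows "a powr p + b powr p \<le> (a + b) powr p"
proof -
  have *: "x powr p \<le> x * (a + b) powr (p - 1)" if "0 \<le> x" "x \<le> a + b" for x
  proof -
    have "x powr p = x * x powr (p - 1)"
      using that powr_mult_base[of x "p - 1"] by simp
    also have "\<dots> \<le> x * (a + b) powr (p - 1)"
      using that assms by (intro mult_left_mono powr_mono2) auto
    finally show ?thesis .
  qed
  have "a powr p + b powr p \<le> (a + b) * (a + b) powr (p - 1)"
    using *[of a] *[of b] assms by (simp add: distrib_right)
  then show ?thesis
    using assms powr_mult_base[of "a + b" "p - 1"] by simp
qed

lemma square_powr: "x \<ge> 0 \<Longrightarrow> (x\<^sup>2) powr p = x powr (2 * p)" for x :: real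
  using powr_powr[of x 2 p] by (cases "x = 0") auto

lemma quadric_eq_norm: "quadric (1 / R\<^sup>2) c \<tau> x = (norm (x - c) / R)\<^sup>2 + \<tau>"
  by (simp add: quadric_def power_divide dot_square_norm)

lemma vimage_quadric_origin: "R > 0 \<Longrightarrow> quadric (1 / R\<^sup>2) 0 0 -` {0<..} = UNIV - {0}"
  by (auto simp: quadric_eq_norm)

lemma vimage_quadric_shifted: "\<tau> > 0 \<Longrightarrow> quadric (1 / R\<^sup>2) c \<tau> -` {0<..} = UNIV"
  by (auto simp: quadric_eq_norm add_nonneg_pos)

text \<open>Dependent choice: what holds for all small radii can be met below one eighth of the
  previous radius. The factor 8 is what separates the supports of the sources.\<close>

lemma decreasing_radii_exist:
  assumes "\<And>j. \<forall>\<^sub>F r in at_right (0::real). P j r"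
  obtains R :: "nat \<Rightarrow> real" where "\<And>j. 0 < R j" "\<And>j. R j < 1" "\<And>j. P j (R j)"
    "\<And>j. R (Suc j) < R j / 8"
proof -
  have ex: "\<exists>r>0. r < d \<and> P j r" if "d > 0" for j d
  proof -
    have "\<forall>\<^sub>F r in at_right 0. 0 < r \<and> r < d \<and> P j r"
      using assms[of j] eventually_at_right_less[of "0::real"] eventually_at_right_real[OF that]
      by eventually_elim auto
    then show ?thesis
      using eventually_happens[of _ "at_right (0::real)"] trivial_limit_at_right_real by blast
  qed
  have "\<exists>R. \<forall>j. (0 < R j \<and> R j < 1 \<and> P j (R j)) \<and> R (Suc j) < R j / 8"
  proof (rule dependent_nat_choice)
    show "\<exists>r. 0 < r \<and> r < 1 \<and> P 0 r" using ex[of 1 0] by auto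
    show "\<exists>r'. (0 < r' \<and> r' < 1 \<and> P (Suc j) r') \<and> r' < r / 8" if "0 < r \<and> r < 1 \<and> P j r" for r j
      using ex[of "r / 8" "Suc j"] that by force
  qed
  then show ?thesis using that by blast
qed

text \<open>\<open>lam_gt\<close> and \<open>D > 0\<close> are the two bounds on the exponent with
  denominators cleared. \<open>e\<close> is the direction of the ray carrying all the
  centres.\<close>

locale singular_pieces = truncated_bubble m n s \<Psi> C0 C1 + compensator m n V g C2 c
  for m :: nat and n s :: real and \<Psi> V g :: "real \<Rightarrow> real" and C0 C1 C2 c :: real +
  fixes lam D :: real and e :: "real^'n::finite"
  assumes m: "odd m" and n: "n = real CARD('n)" "2 * real m < n" and lam_gt: "2 * real m < (n - 2) * (lam - 1)"
    and s: "s = (n - 2 * real m) / 2" and D: "D = n - lam * (n - 2 * real m)" "D > 0"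
    and e: "norm e = 1"
begin

lemma m_pos: "m > 0"
  using m by (cases m) auto

lemma n_gt_2: "n > 2"
proof -
  have "1 \<le> real m" using m_pos by simp
  then show ?thesis using n(2) by linarith
qed

lemma n_eq: "n = 2 * s + 2 * real m"
  using s by (simp add: field_simps)

lemma D_eq: "D = 2 * s + 2 * real m - 2 * s * lam"
proof -
  have "n - 2 * real m = 2 * s" using s by (simp add: field_simps)
  then have "D = n - lam * (2 * s)" using D(1) by simp
  then show ?thesis using n_eq by (simp add: algebra_simps)
qed

lemma lam_gt_1: "lam > 1"
proof -
  have "0 < (n - 2) * (lam - 1)" using lam_gt m_pos by simp
  then show ?thesis using n_gt_2 by (simp add: zero_less_mult_iff)
qed

text \<open>The multiple of the compensator that just beats the cut-off error:
  \<open>M * g t \<ge> C1\<close> wherever \<open>g t \<ge> c\<close>.\<close>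

definition M :: real where "M = C1 / c"

lemma M_nonneg: "M \<ge> 0"
  using C01 g by (simp add: M_def)

definition amp :: "real \<Rightarrow> real \<Rightarrow> real" where
  "amp \<epsilon> R = \<epsilon> * R powr (2 - n)"

text \<open>The square of the width of the bubble, relative to \<open>R\<close>: it is chosen such that the
  source of the bubble equals its \<open>lam\<close>-th power at the centre.\<close>
definition width :: "real \<Rightarrow> real \<Rightarrow> real" where
  "width \<epsilon> R = (C0 * R powr (- 2 * real m) * amp \<epsilon> R powr (1 - lam)) powr (2 / D)"

definition bubble_arg :: "real \<Rightarrow> real \<Rightarrow> real^'n \<Rightarrow> real" where
  "bubble_arg \<epsilon> R = quadric (1 / R\<^sup>2) (R *\<^sub>R e) (width \<epsilon> R)"

definition bubble :: "real \<Rightarrow> real \<Rightarrow> real^'n \<Rightarrow> real" where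
  "bubble \<epsilon> R x = amp \<epsilon> R * \<Psi> (bubble_arg \<epsilon> R x)"

definition piece :: "real \<Rightarrow> real \<Rightarrow> real^'n \<Rightarrow> real" where
  "piece \<epsilon> R x = bubble \<epsilon> R x - M * amp \<epsilon> R * V (quadric (1 / R\<^sup>2) 0 0 x)"

text \<open>Away from the origin this is \<open>- \<Delta>\<^sup>m\<close> of the piece; the power
  of \<open>1 / R\<^sup>2\<close> comes from the rescaling.\<close>

definition source :: "real \<Rightarrow> real \<Rightarrow> real^'n \<Rightarrow> real" where
  "source \<epsilon> R x = amp \<epsilon> R * (1 / R\<^sup>2) ^ m *
     (M * g (quadric (1 / R\<^sup>2) 0 0 x) - (radial_op n (width \<epsilon> R) ^^ m) \<Psi> (bubble_arg \<epsilon> R x))"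

definition fund :: "real^'n \<Rightarrow> real" where
  "fund x = norm x powr (2 - n)"

lemma fund_pos: "x \<noteq> 0 \<Longrightarrow> fund x > 0"
  by (simp add: fund_def)

lemma fund_eq: "fund x = quadric 1 0 0 x powr (1 - n / 2)"
proof -
  have "quadric 1 0 0 x = (norm x)\<^sup>2"
    by (simp add: quadric_def dot_square_norm)
  then show ?thesis by (simp add: fund_def square_powr)
qed

lemma vimage_quadric_one: "quadric 1 (0 :: real^'n) 0 -` {0<..} = UNIV - {0}"
  using vimage_quadric_origin[of 1] by simp

lemma open_punctured: "open (UNIV - {0 :: real^'n})"
  by auto

lemma smooth_on_fund: "smooth_on (UNIV - {0}) fund"
  using smooth_on_radial[OF open_greaterThan smooth_real_on_powr[of "1 - n / 2"], of 1 "0 :: real^'n" 0]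
  unfolding vimage_quadric_one by (simp add: fund_eq[abs_def])

text \<open>A single Laplacian already annihilates the function: for \<open>\<tau> = 0\<close> and
  exponent \<open>1 - n / 2\<close> both terms of \<open>radial_op_powr\<close> vanish.\<close>

lemma iter_laplacian_fund:
  assumes "x \<noteq> 0" shows "iter_laplacian m fund x = 0"
proof -
  let ?F = "\<lambda>t::real. t powr (1 - n / 2)"
  have x: "quadric 1 0 0 x \<in> {0<..}"
    using assms vimage_quadric_one by blast
  obtain k where k: "m = Suc k" using m_pos by (cases m) auto
  have zero: "radial_op n 0 ?F t = 0" if "t > 0" for t
    using radial_op_powr[OF that, of n 0 "1 - n / 2"] by simp
  have "(radial_op n 0 ^^ m) ?F (quadric 1 0 0 x) = (radial_op n 0 ^^ k) (radial_op n 0 ?F) (quadric 1 0 0 x)"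
    unfolding k funpow_Suc_right o_def ..
  also have "\<dots> = (radial_op n 0 ^^ k) (\<lambda>t. 0) (quadric 1 0 0 x)"
    by (rule radial_op_pow_cong[OF open_greaterThan x]) (use zero in auto)
  also have "(radial_op n 0 ^^ k) (\<lambda>t. 0) = (\<lambda>t. 0)"
    by (induction k) (auto simp: radial_op_def)
  finally show ?thesis
    using iter_laplacian_radial[OF open_greaterThan smooth_real_on_powr[of "1 - n / 2"] x, of m]
    by (simp add: fund_eq[abs_def] n(1)[symmetric])
qed

text \<open>The power of 8 undoes the loss in \<open>fund_ge\<close>, where
  \<open>|x|\<^sup>2 \<le> 8 * R\<^sup>2\<close>. The maximum with 1 ensures that the remaining
  constant does not decrease when raised to the power \<open>lam\<close>.\<close>

definition K' :: real where "K' = 8 powr (n / 2 - 1) * max 1 (M + C1)"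

lemma K'_pos: "K' > 0"
  by (simp add: K'_def)

section \<open>A single piece: smoothness, support, sign and size\<close>

context
  fixes \<epsilon> R :: real
  assumes eps: "0 < \<epsilon>" "\<epsilon> \<le> 1" and R: "0 < R" "R < 1" and width_le: "width \<epsilon> R \<le> 1 / 64"
begin

lemma amp_pos: "amp \<epsilon> R > 0"
  using eps R by (simp add: amp_def)

lemma width_pos: "width \<epsilon> R > 0"
  using amp_pos C01 R by (simp add: width_def)

lemma bubble_arg_ge: "bubble_arg \<epsilon> R x \<ge> width \<epsilon> R"
  by (simp add: bubble_arg_def quadric_eq_norm)

lemma bubble_arg_pos: "bubble_arg \<epsilon> R x > 0"
  using bubble_arg_ge width_pos by (rule less_le_trans[rotated])

lemma bubble_nonneg: "bubble \<epsilon> R x \<ge> 0"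
  using amp_pos Psi(2)[OF bubble_arg_pos] by (simp add: bubble_def)

text \<open>On the support of the bubble the distance to the centre is at most \<open>R / 2\<close>,
  so \<open>|x|\<close> lies between \<open>R / 2\<close> and \<open>2 * R\<close>. This places the
  cut-off zone where the compensating bump is bounded below.\<close>

lemma annulus:
  assumes "bubble_arg \<epsilon> R x \<le> 1 / 8"
  shows "1 / 4 \<le> quadric (1 / R\<^sup>2) 0 0 x" "quadric (1 / R\<^sup>2) 0 0 x \<le> 4"
proof -
  have "(norm (x - R *\<^sub>R e) / R)\<^sup>2 \<le> (1 / 2)\<^sup>2"
  proof -
    have "(norm (x - R *\<^sub>R e) / R)\<^sup>2 + width \<epsilon> R \<le> 1 / 8"
      using assms unfolding bubble_arg_def quadric_eq_norm .
    moreover have "(1 / 2)\<^sup>2 = (1 / 4 :: real)" by (simp add: power_divide)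
    ultimately show ?thesis using width_pos by linarith
  qed
  then have "norm (x - R *\<^sub>R e) / R \<le> 1 / 2"
    by (rule power2_le_imp_le) simp
  then have "norm (x - R *\<^sub>R e) \<le> R / 2"
    using R by (simp add: field_simps)
  moreover have "norm (R *\<^sub>R e) = R" using e R by simp
  ultimately have "R / 2 \<le> norm x" "norm x \<le> 2 * R"
    using norm_triangle_ineq2[of "R *\<^sub>R e" x] norm_triangle_ineq2[of x "R *\<^sub>R e"] R
    by (auto simp: norm_minus_commute)
  then have *: "1 / 2 \<le> norm x / R" "norm x / R \<le> 2" using R by (auto simp: field_simps)
  have "(1 / 2)\<^sup>2 \<le> (norm x / R)\<^sup>2" "(norm x / R)\<^sup>2 \<le> 2\<^sup>2"
    using * R by (intro power_mono; simp)+
  then show "1 / 4 \<le> quadric (1 / R\<^sup>2) 0 0 x" "quadric (1 / R\<^sup>2) 0 0 x \<le> 4"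
    unfolding quadric_eq_norm by (simp_all add: power_divide)
qed

lemma smooth_bubble: "smooth_on S (\<lambda>x. \<Psi> (bubble_arg \<epsilon> R x))"
  using smooth_on_radial[OF open_greaterThan Psi(1), of "1 / R\<^sup>2" "R *\<^sub>R e" "width \<epsilon> R"]
  unfolding vimage_quadric_shifted[OF width_pos] by (auto simp: bubble_arg_def intro: smooth_on_subset)

lemma smooth_compensator: "smooth_on (UNIV - {0}) (\<lambda>x :: real^'n. V (quadric (1 / R\<^sup>2) 0 0 x))"
  using smooth_on_radial[OF open_greaterThan V(1), of "1 / R\<^sup>2" "0 :: real^'n" 0]
  unfolding vimage_quadric_origin[OF R(1)] .

lemma piece_eq:
  "piece \<epsilon> R = (\<lambda>x. (0 + amp \<epsilon> R * \<Psi> (bubble_arg \<epsilon> R x)) + (- M * amp \<epsilon> R) * V (quadric (1 / R\<^sup>2) 0 0 x))"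
  by (simp add: piece_def bubble_def fun_eq_iff)

lemma smooth_scaled_bubble: "smooth_on (UNIV - {0}) (\<lambda>x. 0 + amp \<epsilon> R * \<Psi> (bubble_arg \<epsilon> R x))"
  by (intro smooth_on_add smooth_on_mult smooth_on_const smooth_bubble open_punctured)

lemma smooth_piece: "smooth_on (UNIV - {0}) (piece \<epsilon> R)"
  unfolding piece_eq
  by (intro smooth_on_add[OF open_punctured smooth_scaled_bubble] smooth_on_mult smooth_on_const
      smooth_compensator open_punctured)

lemma iter_laplacian_piece:
  assumes "x \<noteq> 0" shows "iter_laplacian m (piece \<epsilon> R) x = - source \<epsilon> R x"
proof -
  have x: "x \<in> UNIV - {0}" using assms by simp
  have q0: "quadric (1 / R\<^sup>2) 0 0 x \<in> {0<..}"
    using x vimage_quadric_origin[OF R(1)] by blast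
  have q1: "quadric (1 / R\<^sup>2) (R *\<^sub>R e) (width \<epsilon> R) x \<in> {0<..}"
    using bubble_arg_pos[of x] by (simp add: bubble_arg_def)
  have zero: "iter_laplacian m (\<lambda>x. 0) x = 0"
    using iter_laplacian_sum[OF open_punctured x, of "{} :: nat set"] by simp
  have "iter_laplacian m (piece \<epsilon> R) x =
      (iter_laplacian m (\<lambda>x. 0) x + amp \<epsilon> R * iter_laplacian m (\<lambda>x. \<Psi> (bubble_arg \<epsilon> R x)) x)
      + (- M * amp \<epsilon> R) * iter_laplacian m (\<lambda>x. V (quadric (1 / R\<^sup>2) 0 0 x)) x"
    unfolding piece_eq
      iter_laplacian_lin[OF open_punctured x smooth_scaled_bubble smooth_compensator]
      iter_laplacian_lin[OF open_punctured x smooth_on_const smooth_bubble] ..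
  also have "iter_laplacian m (\<lambda>x. \<Psi> (bubble_arg \<epsilon> R x)) x
      = (1 / R\<^sup>2) ^ m * (radial_op n (width \<epsilon> R) ^^ m) \<Psi> (bubble_arg \<epsilon> R x)"
    using iter_laplacian_radial[OF open_greaterThan Psi(1) q1, of m]
    unfolding n(1)[symmetric] bubble_arg_def .
  also have "iter_laplacian m (\<lambda>x. V (quadric (1 / R\<^sup>2) 0 0 x)) x
      = (1 / R\<^sup>2) ^ m * g (quadric (1 / R\<^sup>2) 0 0 x)"
    using iter_laplacian_radial[OF open_greaterThan V(1) q0] V(5)[of "quadric (1 / R\<^sup>2) 0 0 x"] q0
    by (simp add: n(1)[symmetric])
  finally show ?thesis unfolding zero by (simp add: source_def algebra_simps)
qed

text \<open>Near the origin \<open>V\<close> need not vanish, but the iterated operator annihilates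
  it because \<open>g\<close> is zero there. Both the bubble and \<open>g\<close> vanish far
  out.\<close>

lemma outside_annulus:
  assumes "quadric (1 / R\<^sup>2) 0 0 x \<le> 1 / 8 \<or> quadric (1 / R\<^sup>2) 0 0 x \<ge> 8"
  shows "source \<epsilon> R x = 0"
proof -
  have "bubble_arg \<epsilon> R x > 1 / 8" using annulus[of x] assms by fastforce
  then show ?thesis using assms g(5,6) op_Psi(3) by (auto simp: source_def)
qed

lemma piece_eq_0:
  assumes "quadric (1 / R\<^sup>2) 0 0 x \<ge> 8"
  shows "piece \<epsilon> R x = 0"
proof -
  have "bubble_arg \<epsilon> R x > 1 / 8" using annulus[of x] assms by fastforce
  then show ?thesis using assms V(2) Psi(4) by (simp add: piece_def bubble_def)
qed

text \<open>Three zones: in the core the bubble has the right sign because \<open>m\<close> is odd;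
  in the cut-off zone its error is at most \<open>C1\<close>, which the compensator covers; beyond,
  only the compensator is left.\<close>

lemma source_nonneg: "source \<epsilon> R x \<ge> 0"
proof -
  let ?t = "bubble_arg \<epsilon> R x" and ?\<rho> = "quadric (1 / R\<^sup>2) 0 0 x"
  have "M * g ?\<rho> - (radial_op n (width \<epsilon> R) ^^ m) \<Psi> ?t \<ge> 0"
  proof -
    consider "?t < 1 / 16" | "1 / 16 \<le> ?t" "?t \<le> 1 / 8" | "1 / 8 < ?t" by linarith
    then show ?thesis
    proof cases
      case 1
      have "(radial_op n (width \<epsilon> R) ^^ m) \<Psi> ?t = - (C0 * width \<epsilon> R ^ m * ?t powr (- s - 2 * real m))"
        using op_Psi(1)[OF bubble_arg_pos 1] m by simp
      moreover have "0 \<le> C0 * width \<epsilon> R ^ m * ?t powr (- s - 2 * real m)"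
        using C01 width_pos by simp
      moreover have "0 \<le> M * g ?\<rho>" using M_nonneg g(1) by simp
      ultimately show ?thesis by linarith
    next
      case 2
      have "C1 = M * c" using g(3) by (simp add: M_def)
      also have "\<dots> \<le> M * g ?\<rho>"
        using annulus[OF 2(2)] g(4) M_nonneg by (intro mult_left_mono) auto
      finally show ?thesis
        using op_Psi(2)[OF _ _ 2, of "width \<epsilon> R"] width_pos width_le by simp
    next
      case 3
      then show ?thesis using op_Psi(3) M_nonneg g(1) by simp
    qed
  qed
  then show ?thesis using amp_pos by (simp add: source_def)
qed

text \<open>The defining equation of the width, solved for the strength of the source. It expresses
  equality of source and \<open>lam\<close>-th power at the centre, since
  \<open>D / 2 = s + real m - s * lam\<close>.\<close>

lemma amp_width: "amp \<epsilon> R * R powr (- 2 * real m) * C0 = amp \<epsilon> R powr lam * width \<epsilon> R powr (D / 2)"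
proof -
  have "width \<epsilon> R powr (D / 2) = C0 * R powr (- 2 * real m) * amp \<epsilon> R powr (1 - lam)"
    unfolding width_def powr_powr using D(2) C01 R amp_pos by simp
  moreover have "amp \<epsilon> R powr lam * amp \<epsilon> R powr (1 - lam) = amp \<epsilon> R"
    using amp_pos by (simp flip: powr_add)
  ultimately show ?thesis by (simp add: mult_ac)
qed

lemma scale_power: "(1 / R\<^sup>2) ^ m = R powr (- 2 * real m)"
proof -
  have "(1 / R\<^sup>2) ^ m = 1 / R ^ (2 * m)"
    by (simp add: power_divide power_mult)
  also have "R ^ (2 * m) = R powr (2 * real m)"
    using R powr_realpow[of R "2 * m"] by simp
  finally show ?thesis by (simp add: powr_minus divide_inverse)
qed

text \<open>At the centre the argument equals the width and both sides agree. Elsewhere the argument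
  is larger, and as the exponent \<open>D / 2 + real m\<close> is positive, the width may be
  replaced by it.\<close>

lemma core_source_le:
  assumes "0 < bubble_arg \<epsilon> R x" "bubble_arg \<epsilon> R x < 1 / 16"
  shows "amp \<epsilon> R * R powr (- 2 * real m) * (C0 * width \<epsilon> R ^ m * bubble_arg \<epsilon> R x powr (- s - 2 * real m))
    \<le> bubble \<epsilon> R x powr lam"
proof -
  let ?t = "bubble_arg \<epsilon> R x" and ?q = "D / 2 + real m"
  have q: "?q = s + 2 * real m - s * lam" by (simp add: D_eq field_simps)
  have "amp \<epsilon> R * R powr (- 2 * real m) * (C0 * width \<epsilon> R ^ m * ?t powr (- s - 2 * real m))
      = (amp \<epsilon> R * R powr (- 2 * real m) * C0) * width \<epsilon> R powr real m * ?t powr (- s - 2 * real m)"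
    using width_pos by (simp add: powr_realpow)
  also have "\<dots> = amp \<epsilon> R powr lam * (width \<epsilon> R powr ?q * ?t powr (- s - 2 * real m))"
    unfolding amp_width powr_add by simp
  also have "\<dots> \<le> amp \<epsilon> R powr lam * (?t powr ?q * ?t powr (- s - 2 * real m))"
    using width_pos bubble_arg_ge[of x] D(2)
    by (intro mult_left_mono mult_right_mono powr_mono2) auto
  also have "?t powr ?q * ?t powr (- s - 2 * real m) = (?t powr - s) powr lam"
    unfolding powr_add[symmetric] powr_powr q by simp
  also have "amp \<epsilon> R powr lam * (?t powr - s) powr lam = bubble \<epsilon> R x powr lam"
    using amp_pos assms Psi(3) by (simp add: bubble_def powr_mult)
  finally show ?thesis .
qed

text \<open>The two terms are absorbed separately: the bounded one by the fundamental solution, the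
  concentrated one by the power of the bubble itself.\<close>

lemma source_le:
  "source \<epsilon> R x \<le> amp \<epsilon> R * R powr (- 2 * real m) * (M + C1) + bubble \<epsilon> R x powr lam"
proof -
  let ?t = "bubble_arg \<epsilon> R x" and ?\<rho> = "quadric (1 / R\<^sup>2) 0 0 x"
  let ?a = "amp \<epsilon> R * R powr (- 2 * real m)"
  have a: "?a \<ge> 0" using amp_pos by simp
  have src: "source \<epsilon> R x = ?a * (M * g ?\<rho> - (radial_op n (width \<epsilon> R) ^^ m) \<Psi> ?t)"
    by (simp only: source_def scale_power)
  have Mg: "M * g ?\<rho> \<le> M" using M_nonneg g(2) by (simp add: mult_left_le)
  show ?thesis
  proof (cases "?t < 1 / 16")
    case True
    have "(radial_op n (width \<epsilon> R) ^^ m) \<Psi> ?t = - (C0 * width \<epsilon> R ^ m * ?t powr (- s - 2 * real m))"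
      using op_Psi(1)[OF bubble_arg_pos True] m by simp
    then have "source \<epsilon> R x = ?a * (M * g ?\<rho>) + ?a * (C0 * width \<epsilon> R ^ m * ?t powr (- s - 2 * real m))"
      unfolding src by (simp only: diff_minus_eq_add distrib_left)
    also have "\<dots> \<le> ?a * (M + C1) + bubble \<epsilon> R x powr lam"
      using Mg C01 a bubble_arg_pos True by (intro add_mono mult_left_mono core_source_le) auto
    finally show ?thesis .
  next
    case False
    have "\<bar>(radial_op n (width \<epsilon> R) ^^ m) \<Psi> ?t\<bar> \<le> C1"
      using op_Psi(2)[of "width \<epsilon> R" ?t] op_Psi(3)[of ?t "width \<epsilon> R"] C01 width_pos width_le False
      by (cases "?t \<le> 1 / 8") auto
    then have "?a * (M * g ?\<rho> - (radial_op n (width \<epsilon> R) ^^ m) \<Psi> ?t) \<le> ?a * (M + C1)"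
      using Mg a by (intro mult_left_mono) auto
    then show ?thesis unfolding src by (simp add: add_increasing2)
  qed
qed

lemma fund_ge:
  assumes "x \<noteq> 0" "quadric (1 / R\<^sup>2) 0 0 x \<le> 8"
  shows "8 powr (1 - n / 2) * R powr (2 - n) \<le> fund x"
proof -
  have "(norm x)\<^sup>2 \<le> 8 * R\<^sup>2"
    using assms(2) R unfolding quadric_eq_norm by (simp add: power_divide field_simps)
  then have "(8 * R\<^sup>2) powr (1 - n / 2) \<le> (norm x)\<^sup>2 powr (1 - n / 2)"
    using assms(1) n_gt_2 by (intro powr_mono2') auto
  then show ?thesis
    using R by (simp add: fund_def powr_mult square_powr)
qed

text \<open>Here the lower bound on \<open>lam\<close> enters: by \<open>exponent\<close> and
  \<open>R < 1\<close>, the scale \<open>R powr (2 - n - 2 * real m)\<close> is at most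
  \<open>R powr ((2 - n) * lam)\<close>, the size of the \<open>lam\<close>-th power of
  \<open>fund\<close> on the annulus.\<close>

lemma regular_source_le:
  assumes "x \<noteq> 0" "quadric (1 / R\<^sup>2) 0 0 x \<le> 8"
  shows "amp \<epsilon> R * R powr (- 2 * real m) * (M + C1) \<le> (K' * fund x) powr lam"
proof -
  let ?L = "max 1 (M + C1)"
  have MC: "0 \<le> M + C1" using M_nonneg C01 by simp
  have exponent: "(2 - n) * lam \<le> 2 - n - 2 * real m"
    using lam_gt by (simp add: algebra_simps)
  have "amp \<epsilon> R * R powr (- 2 * real m) * (M + C1) = \<epsilon> * (M + C1) * R powr (2 - n - 2 * real m)"
    by (simp add: amp_def powr_diff powr_minus divide_inverse mult_ac)
  also have "\<dots> \<le> 1 * ?L * R powr ((2 - n) * lam)"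
    using eps R MC exponent by (intro mult_mono powr_mono') auto
  also have "\<dots> \<le> ?L powr lam * R powr ((2 - n) * lam)"
    using powr_mono[of 1 lam ?L] lam_gt_1 by (intro mult_right_mono) auto
  also have "\<dots> = (?L * R powr (2 - n)) powr lam"
    using R by (simp add: powr_mult powr_powr)
  also have "?L * R powr (2 - n) = K' * (8 powr (1 - n / 2) * R powr (2 - n))"
  proof -
    have "8 powr (n / 2 - 1) * 8 powr (1 - n / 2) = (1 :: real)"
      by (simp flip: powr_add)
    then show ?thesis unfolding K'_def by (simp add: mult_ac)
  qed
  also have "\<dots> powr lam \<le> (K' * fund x) powr lam"
    using fund_ge[OF assms] lam_gt_1 R by (intro powr_mono2 mult_left_mono) (auto simp: K'_def)
  finally show ?thesis .
qed

text \<open>The amplitude cancels the scaling of the fundamental profile, so the cost of the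
  compensator is independent of \<open>R\<close> and can be summed over all pieces.\<close>

lemma piece_ge:
  assumes "x \<noteq> 0"
  shows "piece \<epsilon> R x \<ge> bubble \<epsilon> R x - M * C2 * \<epsilon> * fund x"
proof -
  let ?\<rho> = "quadric (1 / R\<^sup>2) 0 0 x"
  have \<rho>: "?\<rho> > 0" using assms R by (simp add: quadric_eq_norm)
  have "amp \<epsilon> R * ?\<rho> powr (1 - n / 2) = \<epsilon> * fund x"
  proof -
    have "?\<rho> powr (1 - n / 2) = (norm x / R) powr (2 - n)"
      using R by (simp add: quadric_eq_norm square_powr)
    then show ?thesis using R by (simp add: amp_def fund_def powr_divide)
  qed
  moreover have "M * amp \<epsilon> R * V ?\<rho> \<le> M * amp \<epsilon> R * (C2 * ?\<rho> powr (1 - n / 2))"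
    using V(3)[OF \<rho>] M_nonneg amp_pos by (intro mult_left_mono) auto
  ultimately have "M * amp \<epsilon> R * V ?\<rho> \<le> M * C2 * (\<epsilon> * fund x)"
    by (metis (no_types, opaque_lifting) mult.assoc mult.left_commute)
  then show ?thesis by (simp add: piece_def mult_ac)
qed

text \<open>The width is inserted and the exponents are collected; \<open>D_eq\<close> simplifies
  that of the amplitude and \<open>n_eq\<close> that of \<open>R\<close>. The resulting power of
  \<open>R\<close> is the exponent \<open>- a\<close> of the theorem.\<close>

lemma bubble_centre:
  "bubble \<epsilon> R (R *\<^sub>R e) = C0 powr (- 2 * s / D) * \<epsilon> powr (2 * real m / D)
     * R powr (- (4 * real m * (real m - 1) / D))"
proof -
  have "bubble_arg \<epsilon> R (R *\<^sub>R e) = width \<epsilon> R"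
    by (simp add: bubble_arg_def quadric_eq_norm)
  then have "bubble \<epsilon> R (R *\<^sub>R e) = amp \<epsilon> R * width \<epsilon> R powr - s"
    using Psi(3)[OF width_pos] width_le by (simp add: bubble_def)
  also have "width \<epsilon> R powr - s
      = C0 powr (- 2 * s / D) * R powr (4 * real m * s / D) * amp \<epsilon> R powr ((lam - 1) * 2 * s / D)"
    using C01 R amp_pos unfolding width_def powr_powr
    by (simp add: powr_mult powr_powr) (simp add: field_simps minus_divide_left)
  also have "amp \<epsilon> R * (C0 powr (- 2 * s / D) * R powr (4 * real m * s / D) * amp \<epsilon> R powr ((lam - 1) * 2 * s / D))
      = C0 powr (- 2 * s / D) * R powr (4 * real m * s / D) * amp \<epsilon> R powr (1 + (lam - 1) * 2 * s / D)"
    using amp_pos by (simp add: powr_add)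
  also have "1 + (lam - 1) * 2 * s / D = 2 * real m / D"
    using D_eq D(2) by (simp add: field_simps)
  also have "amp \<epsilon> R powr (2 * real m / D) = \<epsilon> powr (2 * real m / D) * R powr ((2 - n) * (2 * real m / D))"
    using eps R by (simp add: amp_def powr_mult powr_powr)
  also have "C0 powr (- 2 * s / D) * R powr (4 * real m * s / D)
        * (\<epsilon> powr (2 * real m / D) * R powr ((2 - n) * (2 * real m / D)))
      = C0 powr (- 2 * s / D) * \<epsilon> powr (2 * real m / D)
        * R powr (4 * real m * s / D + (2 - n) * (2 * real m / D))"
    by (simp add: powr_add)
  also have "4 * real m * s / D + (2 - n) * (2 * real m / D) = - (4 * real m * (real m - 1) / D)"
    using D(2) n_eq by (simp add: field_simps)
  finally show ?thesis .
qed

end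

section \<open>The sum of all pieces\<close>

context
  fixes \<epsilon> R :: "nat \<Rightarrow> real"
  assumes eps: "\<And>j. 0 < \<epsilon> j" "\<And>J. (\<Sum>j<J. \<epsilon> j) \<le> 1"
    and R: "\<And>j. 0 < R j" "\<And>j. R j < 1" "\<And>j. R (Suc j) < R j / 8"
    and width_le: "\<And>j. width (\<epsilon> j) (R j) \<le> 1 / 64"
begin

lemma eps_le_1: "\<epsilon> j \<le> 1"
proof -
  have "\<epsilon> j \<le> (\<Sum>i<Suc j. \<epsilon> i)"
    using eps(1) by (simp add: sum_nonneg less_imp_le)
  then show ?thesis using eps(2)[of "Suc j"] by linarith
qed

lemmas admissible = eps(1) eps_le_1 R(1,2) width_le

lemma R_step: "j < k \<Longrightarrow> R k < R j / 8"
proof (induction k)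
  case (Suc k)
  show ?case
  proof (cases "j = k")
    case False
    then have "R k < R j / 8" using Suc by simp
    then show ?thesis using R(1)[of j] R(1)[of k] R(3)[of k] by linarith
  qed (use R(3) in simp)
qed simp

lemma R_le: "R j \<le> (1 / 8) ^ j"
proof (induction j)
  case 0
  then show ?case using R(2)[of 0] by simp
next
  case (Suc j)
  then show ?case using R(3)[of j] by simp
qed

lemma R_tendsto_0: "R \<longlonglongrightarrow> 0"
proof (rule tendsto_sandwich[of "\<lambda>_. 0" R _ "\<lambda>j. (1 / 8) ^ j"])
  show "(\<lambda>j. (1 / 8 :: real) ^ j) \<longlonglongrightarrow> 0" by (rule LIMSEQ_power_zero) simp
qed (use R(1) R_le in \<open>auto simp: less_imp_le\<close>)

text \<open>The multiple \<open>M * C2\<close> of \<open>fund\<close> pays for all compensators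
  together; the multiple \<open>K'\<close> remains for positivity and for absorbing the regular
  parts of the sources.\<close>

definition sol :: "real^'n \<Rightarrow> real" where
  "sol x = (K' + M * C2) * fund x + (\<Sum>j. piece (\<epsilon> j) (R j) x)"

lemma sol_locally_finite:
  assumes "x \<noteq> 0"
  obtains T :: "(real^'n) set" and J0 where "open T" "x \<in> T" "T \<subseteq> UNIV - {0}"
    "\<And>J y. J \<ge> J0 \<Longrightarrow> y \<in> T \<Longrightarrow> sol y = (K' + M * C2) * fund y + (\<Sum>j<J. piece (\<epsilon> j) (R j) y)"
proof -
  define T where "T = {y :: real^'n. norm x / 2 < norm y}"
  have "open T" unfolding T_def by (intro open_Collect_less continuous_intros)
  moreover have "x \<in> T" "T \<subseteq> UNIV - {0}" using assms by (auto simp: T_def)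
  \<comment> \<open>On \<open>T\<close> this gives \<open>3 * R j < norm y\<close>, hence a squared
    ratio of at least 9, past the threshold 8.\<close>
  moreover have "\<forall>\<^sub>F j in sequentially. R j < norm x / 6"
    using assms by (intro order_tendstoD(2)[OF R_tendsto_0]) simp
  then obtain J0 where J0: "\<And>j. j \<ge> J0 \<Longrightarrow> R j < norm x / 6"
    unfolding eventually_sequentially by blast
  have "sol y = (K' + M * C2) * fund y + (\<Sum>j<J. piece (\<epsilon> j) (R j) y)" if "J \<ge> J0" "y \<in> T" for J y
  proof -
    have "piece (\<epsilon> j) (R j) y = 0" if "j \<notin> {..<J}" for j
    proof (rule piece_eq_0[OF admissible])
      have "3 * R j < norm y" using J0[of j] that \<open>J \<ge> J0\<close> \<open>y \<in> T\<close> by (auto simp: T_def)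
      then have "3 \<le> norm y / R j" using R(1)[of j] by (simp add: field_simps)
      then have "3\<^sup>2 \<le> (norm y / R j)\<^sup>2" by (intro power_mono) auto
      then show "8 \<le> quadric (1 / (R j)\<^sup>2) 0 0 y" unfolding quadric_eq_norm by simp
    qed
    then have "(\<Sum>j. piece (\<epsilon> j) (R j) y) = (\<Sum>j<J. piece (\<epsilon> j) (R j) y)"
      by (intro suminf_finite) auto
    then show ?thesis by (simp add: sol_def)
  qed
  ultimately show ?thesis using that by blast
qed

lemma smooth_partial_sum:
  "smooth_on (UNIV - {0}) (\<lambda>y. (\<Sum>j<J. piece (\<epsilon> j) (R j) y) + (K' + M * C2) * fund y)"
  by (intro smooth_on_add smooth_on_sum smooth_on_mult smooth_on_const smooth_on_fund
      smooth_piece[OF admissible] open_punctured)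

lemma smooth_on_sol: "smooth_on (UNIV - {0}) sol"
proof (rule smooth_on_locally)
  fix x :: "real^'n" assume "x \<in> UNIV - {0}"
  then have "x \<noteq> 0" by simp
  then obtain T J0 where T: "open T" "x \<in> T" "T \<subseteq> UNIV - {0}"
    "\<And>J y. J \<ge> J0 \<Longrightarrow> y \<in> T \<Longrightarrow> sol y = (K' + M * C2) * fund y + (\<Sum>j<J. piece (\<epsilon> j) (R j) y)"
    by (rule sol_locally_finite) blast
  have "smooth_on T sol"
    by (rule smooth_on_cong[OF T(1) smooth_on_subset[OF smooth_partial_sum[of J0] T(3)]])
      (simp add: T(4)[of J0])
  with T(1,2) show "\<exists>T. open T \<and> x \<in> T \<and> smooth_on T sol" by blast
qed

lemma iter_laplacian_sol:
  assumes "x \<noteq> 0"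
  obtains J where "- iter_laplacian m sol x = (\<Sum>j<J. source (\<epsilon> j) (R j) x)"
proof -
  obtain T J where T: "open T" "x \<in> T" "T \<subseteq> UNIV - {0}"
    "\<And>J' y. J' \<ge> J \<Longrightarrow> y \<in> T \<Longrightarrow> sol y = (K' + M * C2) * fund y + (\<Sum>j<J'. piece (\<epsilon> j) (R j) y)"
    using sol_locally_finite[OF assms] by blast
  have x: "x \<in> UNIV - {0}" using assms by simp
  have "iter_laplacian m sol x
      = iter_laplacian m (\<lambda>y. (\<Sum>j<J. piece (\<epsilon> j) (R j) y) + (K' + M * C2) * fund y) x"
    by (rule iter_laplacian_cong_open[OF T(1,2)]) (simp add: T(4)[of J])
  also have "\<dots> = iter_laplacian m (\<lambda>y. \<Sum>j<J. piece (\<epsilon> j) (R j) y) x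
      + (K' + M * C2) * iter_laplacian m fund x"
    by (intro iter_laplacian_lin[OF open_punctured x] smooth_on_sum smooth_on_fund
        smooth_piece[OF admissible] open_punctured)
  also have "\<dots> = (\<Sum>j<J. - source (\<epsilon> j) (R j) x)"
    using iter_laplacian_sum[OF open_punctured x, of "{..<J}" "\<lambda>j. piece (\<epsilon> j) (R j)" m]
    by (simp add: smooth_piece[OF admissible] iter_laplacian_piece[OF admissible assms]
        iter_laplacian_fund[OF assms])
  finally show ?thesis using that[of J] by (simp add: sum_negf)
qed

text \<open>The other bubbles are nonnegative, and the compensators cost at most
  \<open>M * C2 * fund x\<close> altogether because the partial sums of \<open>\<epsilon>\<close> do
  not exceed 1.\<close>

lemma sol_ge:
  assumes "x \<noteq> 0"
  shows "sol x \<ge> K' * fund x + bubble (\<epsilon> k) (R k) x"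
proof -
  obtain T J where T: "open T" "x \<in> T" "T \<subseteq> UNIV - {0}"
    "\<And>J' y. J' \<ge> J \<Longrightarrow> y \<in> T \<Longrightarrow> sol y = (K' + M * C2) * fund y + (\<Sum>j<J'. piece (\<epsilon> j) (R j) y)"
    using sol_locally_finite[OF assms] by blast
  define L where "L = max J (Suc k)"
  have "bubble (\<epsilon> k) (R k) x \<le> (\<Sum>j<L. bubble (\<epsilon> j) (R j) x)"
    by (rule member_le_sum) (auto simp: L_def bubble_nonneg[OF admissible])
  moreover have "(\<Sum>j<L. bubble (\<epsilon> j) (R j) x - M * C2 * \<epsilon> j * fund x) \<le> (\<Sum>j<L. piece (\<epsilon> j) (R j) x)"
    by (intro sum_mono piece_ge[OF admissible assms])
  moreover have "(\<Sum>j<L. M * C2 * \<epsilon> j * fund x) \<le> M * C2 * fund x"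
  proof -
    have "(\<Sum>j<L. M * C2 * \<epsilon> j * fund x) = (M * C2 * fund x) * (\<Sum>j<L. \<epsilon> j)"
      by (simp add: sum_distrib_left mult_ac)
    also have "\<dots> \<le> M * C2 * fund x"
      using eps(2) M_nonneg V(4) fund_pos[OF assms] by (intro mult_left_le) auto
    finally show ?thesis .
  qed
  moreover have "sol x = (K' + M * C2) * fund x + (\<Sum>j<L. piece (\<epsilon> j) (R j) x)"
    using T(2) by (intro T(4)) (auto simp: L_def)
  ultimately show ?thesis unfolding sum_subtractf distrib_right by linarith
qed

lemma sol_pos:
  assumes "x \<noteq> 0" shows "sol x > 0"
proof -
  have "0 < K' * fund x" using K'_pos fund_pos[OF assms] by simp
  then show ?thesis
    using sol_ge[OF assms, of 0] bubble_nonneg[OF admissible, of 0 x] by linarith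
qed

text \<open>A nonzero source forces \<open>|x|\<^sup>2 / R\<^sup>2\<close> strictly between 1/8 and
  8. Passing to a later radius multiplies this ratio by more than 64, which carries it out of that
  range.\<close>

lemma source_disjoint:
  assumes "source (\<epsilon> j) (R j) x \<noteq> 0" "source (\<epsilon> k) (R k) x \<noteq> 0"
  shows "j = k"
proof -
  have rho: "1 / 8 < (norm x / R i)\<^sup>2" "(norm x / R i)\<^sup>2 < 8" if "source (\<epsilon> i) (R i) x \<noteq> 0" for i
  proof -
    have "\<not> (quadric (1 / (R i)\<^sup>2) 0 0 x \<le> 1 / 8 \<or> quadric (1 / (R i)\<^sup>2) 0 0 x \<ge> 8)"
      using outside_annulus[OF admissible, of i x] that by blast
    then show "1 / 8 < (norm x / R i)\<^sup>2" "(norm x / R i)\<^sup>2 < 8"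
      unfolding quadric_eq_norm by auto
  qed
  have *: "\<not> i < l" if "source (\<epsilon> i) (R i) x \<noteq> 0" "source (\<epsilon> l) (R l) x \<noteq> 0" for i l
  proof
    assume "i < l"
    then have "8 * R l < R i" using R_step by fastforce
    then have "8 * (norm x / R i) \<le> norm x / R l"
      using R(1)[of l] R(1)[of i] mult_left_mono[of "8 * R l" "R i" "norm x"]
      by (simp add: field_simps)
    then have "(8 * (norm x / R i))\<^sup>2 \<le> (norm x / R l)\<^sup>2"
      using R(1)[of i] by (intro power_mono) auto
    then have "64 * (norm x / R i)\<^sup>2 \<le> (norm x / R l)\<^sup>2"
      by (simp only: power_mult_distrib) simp
    then show False using rho(1)[OF that(1)] rho(2)[OF that(2)] by linarith
  qed
  show ?thesis using *[of j k] *[of k j] assms by (meson linorder_neqE_nat)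
qed

text \<open>On the ball of the piece both parts of the source are absorbed and recombined by
  superadditivity; elsewhere the source is zero.\<close>

lemma source_le_sol:
  assumes "x \<noteq> 0"
  shows "source (\<epsilon> j) (R j) x \<le> sol x powr lam"
proof (cases "quadric (1 / (R j)\<^sup>2) 0 0 x \<le> 8")
  case True
  have "source (\<epsilon> j) (R j) x \<le> (K' * fund x) powr lam + bubble (\<epsilon> j) (R j) x powr lam"
    using source_le[OF admissible] regular_source_le[OF admissible assms True]
    by (meson add_mono_thms_linordered_semiring(3) order_trans)
  also have "\<dots> \<le> (K' * fund x + bubble (\<epsilon> j) (R j) x) powr lam"
    using K'_pos fund_pos[OF assms] bubble_nonneg[OF admissible] lam_gt_1
    by (intro powr_superadditive) auto
  also have "\<dots> \<le> sol x powr lam"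
    using K'_pos fund_pos[OF assms] bubble_nonneg[OF admissible] lam_gt_1 sol_ge[OF assms]
    by (intro powr_mono2) auto
  finally show ?thesis .
next
  case False
  then have "source (\<epsilon> j) (R j) x = 0" by (intro outside_annulus[OF admissible]) auto
  then show ?thesis by simp
qed

text \<open>At each point at most one source is nonzero, so the sum obeys the bound of a single
  source.\<close>

lemma sol_inequality:
  assumes "x \<noteq> 0"
  shows "0 \<le> - iter_laplacian m sol x" "- iter_laplacian m sol x \<le> sol x powr lam"
proof -
  obtain J where J: "- iter_laplacian m sol x = (\<Sum>j<J. source (\<epsilon> j) (R j) x)"
    using iter_laplacian_sol[OF assms] .
  show "0 \<le> - iter_laplacian m sol x"
    unfolding J by (intro sum_nonneg source_nonneg[OF admissible])
  show "- iter_laplacian m sol x \<le> sol x powr lam"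
  proof (cases "\<exists>k<J. source (\<epsilon> k) (R k) x \<noteq> 0")
    case True
    then obtain k where k: "k < J" "source (\<epsilon> k) (R k) x \<noteq> 0" by blast
    have "(\<Sum>j<J. source (\<epsilon> j) (R j) x) = (\<Sum>j\<in>{k}. source (\<epsilon> j) (R j) x)"
      using k source_disjoint by (intro sum.mono_neutral_right) auto
    then show ?thesis using J source_le_sol[OF assms, of k] by simp
  next
    case False
    then have "(\<Sum>j<J. source (\<epsilon> j) (R j) x) = 0" by simp
    then show ?thesis using J by simp
  qed
qed

lemma sol_centre_gt: "sol (R j *\<^sub>R e) > C0 powr (- 2 * s / D) * \<epsilon> j powr (2 * real m / D)
     * R j powr (- (4 * real m * (real m - 1) / D))"
proof -
  have "R j *\<^sub>R e \<noteq> 0" using R(1)[of j] e by auto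
  then have "0 < K' * fund (R j *\<^sub>R e)" using K'_pos fund_pos by simp
  with sol_ge[OF \<open>R j *\<^sub>R e \<noteq> 0\<close>, of j] show ?thesis
    unfolding bubble_centre[OF admissible] by linarith
qed

end

text \<open>For fixed \<open>\<epsilon>\<close> the width is a constant times a power of
  \<open>R\<close>, and the lower bound on \<open>lam\<close> says precisely that the exponent
  \<open>?b\<close> is positive.\<close>

lemma width_tendsto_0:
  assumes "\<epsilon> > 0"
  shows "(width \<epsilon> \<longlongrightarrow> 0) (at_right 0)"
proof -
  let ?b = "(- 2 * real m + (2 - n) * (1 - lam)) * (2 / D)"
  let ?K = "(C0 * \<epsilon> powr (1 - lam)) powr (2 / D)"
  have "(2 - n) * (1 - lam) = (n - 2) * (lam - 1)" by (simp add: algebra_simps)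
  then have b: "?b > 0" using lam_gt D(2) by (intro mult_pos_pos) auto
  have "((\<lambda>R::real. R powr ?b) \<longlongrightarrow> 0) (at_right 0)"
    using b by (intro tendsto_zero_powrI[of _ _ _ ?b] tendsto_const tendsto_ident_at)
      (auto simp: eventually_at_filter)
  then have "((\<lambda>R. ?K * R powr ?b) \<longlongrightarrow> ?K * 0) (at_right 0)"
    by (rule tendsto_mult_left)
  moreover have "\<forall>\<^sub>F R in at_right 0. ?K * R powr ?b = width \<epsilon> R"
    using eventually_at_right_less[of "0::real"]
  proof eventually_elim
    case (elim R)
    have "C0 * R powr (- 2 * real m) * amp \<epsilon> R powr (1 - lam)
        = C0 * \<epsilon> powr (1 - lam) * R powr (- 2 * real m + (2 - n) * (1 - lam))"
      using elim assms unfolding powr_add amp_def by (simp add: powr_mult powr_powr)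
    then have "width \<epsilon> R
        = (C0 * \<epsilon> powr (1 - lam) * R powr (- 2 * real m + (2 - n) * (1 - lam))) powr (2 / D)"
      by (simp only: width_def)
    also have "\<dots> = ?K * (R powr (- 2 * real m + (2 - n) * (1 - lam))) powr (2 / D)"
      by (rule powr_mult)
    finally show ?case by (simp only: powr_powr)
  qed
  ultimately show ?thesis
    using Lim_transform_eventually[of _ _ "at_right 0" "width \<epsilon>"] by simp
qed

end

section \<open>Choice of the parameters and comparison with \<phi>\<close>

theorem theorem1p5:
  fixes m :: nat and lam a :: real and \<phi> :: "real \<Rightarrow> real"
  assumes "odd m" and "m \<ge> 3" and "2 * m < CARD('n)"
    and "(2 * real m + real CARD('n) - 2) / (real CARD('n) - 2) < lam"
    and "lam < real CARD('n) / (real CARD('n) - 2 * real m)"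
    and "a = 4 * real m * (real m - 1) / (real CARD('n) - lam * (real CARD('n) - 2 * real m))"
    and "continuous_on {0<..<1} \<phi>"
    and "\<phi> ` {0<..<1} \<subseteq> {0<..<1}"
    and "(\<phi> \<longlongrightarrow> 0) (at_right 0)"
  shows "\<exists>u :: real^'n \<Rightarrow> real.
           smooth_on (UNIV - {0}) u
         \<and> (\<forall>x. x \<noteq> 0 \<longrightarrow> u x > 0)
         \<and> (\<forall>x. x \<noteq> 0 \<longrightarrow> 0 \<le> - iter_laplacian m u x \<and> - iter_laplacian m u x \<le> u x powr lam)
         \<and> (\<forall>M. \<exists>\<^sub>F x in at 0. u x / (\<phi> (norm x) * norm x powr (- a)) > M)"
proof -
  define n where "n = real CARD('n)"
  define s where "s = (n - 2 * real m) / 2"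
  define D where "D = n - lam * (n - 2 * real m)"
  define e :: "real^'n" where "e = axis undefined 1"
  have n: "2 * real m < n" "n > 2"
    using assms(2,3) by (auto simp: n_def)
  have s: "s > 0" "n = 2 * s + 2 * real m"
    using n by (auto simp: s_def field_simps)
  have D: "D > 0"
    using assms(5) n by (simp add: D_def n_def field_simps)
  have "2 * real m + n - 2 < lam * (n - 2)"
    using assms(4) n by (simp add: n_def divide_less_eq)
  then have lam: "2 * real m < (n - 2) * (lam - 1)"
    by (simp add: algebra_simps)
  have e: "norm e = 1" by (simp add: e_def)
  obtain \<Psi> C0 C1 where "truncated_bubble m n s \<Psi> C0 C1"
    using truncated_bubble_exists[OF s(2,1)] .
  then interpret truncated_bubble m n s \<Psi> C0 C1 .
  obtain V g C2 c where "compensator m n V g C2 c"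
    using compensator_exists[OF n(2)] .
  then interpret compensator m n V g C2 c .
  interpret singular_pieces m n s \<Psi> V g C0 C1 C2 c lam D e
    by unfold_locales (use assms(1) n_def n(1) lam s_def D_def D e in auto)
  \<comment> \<open>The shift to \<open>Suc j\<close> makes the geometric series sum to 1.\<close>
  define \<epsilon> :: "nat \<Rightarrow> real" where "\<epsilon> = (\<lambda>j. (1 / 2) ^ Suc j)"
  have eps: "\<epsilon> j > 0" for j by (simp add: \<epsilon>_def)
  have "(\<Sum>j<J. \<epsilon> j) = 1 - (1 / 2) ^ J" for J
    by (induction J) (auto simp: \<epsilon>_def)
  then have eps_sum: "(\<Sum>j<J. \<epsilon> j) \<le> 1" for J by simp
  \<comment> \<open>The factor in front of \<open>R j powr (- a)\<close> in the lower bound for the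
    value at the \<open>j\<close>-th centre; it does not depend on \<open>R j\<close>.\<close>
  define B where "B = (\<lambda>j. C0 powr (- 2 * s / D) * \<epsilon> j powr (2 * real m / D))"
  have B: "B j > 0" for j using C01(1) eps[of j] by (simp add: B_def)
  \<comment> \<open>Both conditions hold for all small radii. The second makes \<phi> so small at
    the \<open>j\<close>-th radius that the quotient at the centre exceeds
    \<open>Suc j\<close>.\<close>
  have "\<forall>\<^sub>F r in at_right 0. width (\<epsilon> j) r \<le> 1 / 64 \<and> \<phi> r < B j / real (Suc j)" for j
  proof (rule eventually_conj)
    show "\<forall>\<^sub>F r in at_right 0. width (\<epsilon> j) r \<le> 1 / 64"
      using order_tendstoD(2)[OF width_tendsto_0[OF eps[of j]], of "1 / 64"]
      by (auto elim: eventually_mono)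
    show "\<forall>\<^sub>F r in at_right 0. \<phi> r < B j / real (Suc j)"
      using B[of j] by (intro order_tendstoD(2)[OF assms(9)]) simp
  qed
  then obtain R where R: "\<And>j. 0 < R j" "\<And>j. R j < 1" "\<And>j. R (Suc j) < R j / 8"
    and "\<And>j. width (\<epsilon> j) (R j) \<le> 1 / 64 \<and> \<phi> (R j) < B j / real (Suc j)"
    by (rule decreasing_radii_exist[where P = "\<lambda>j r. width (\<epsilon> j) r \<le> 1 / 64 \<and> \<phi> r < B j / real (Suc j)"]) blast
  then have W: "\<And>j. width (\<epsilon> j) (R j) \<le> 1 / 64" and phi: "\<And>j. \<phi> (R j) < B j / real (Suc j)"
    by auto
  note prems = eps eps_sum R W
  define u where "u = sol \<epsilon> R"
  \<comment> \<open>Otherwise the quotient would be at most \<open>K\<close> on a punctured ball.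
    For large \<open>j\<close> the centre \<open>R j *\<^sub>R e\<close> lies in that ball, and
    there the quotient exceeds \<open>Suc j\<close>, hence \<open>K\<close>.\<close>
  have "\<exists>\<^sub>F x in at 0. u x / (\<phi> (norm x) * norm x powr (- a)) > K" for K
    unfolding frequently_def
  proof
    assume "\<forall>\<^sub>F x in at 0. \<not> u x / (\<phi> (norm x) * norm x powr (- a)) > K"
    then obtain d where d: "d > 0"
      "\<And>x. x \<noteq> 0 \<Longrightarrow> dist x 0 < d \<Longrightarrow> \<not> u x / (\<phi> (norm x) * norm x powr (- a)) > K"
      unfolding eventually_at by auto
    have "\<forall>\<^sub>F j in sequentially. R j < d \<and> K < real j"
      using order_tendstoD(2)[OF R_tendsto_0[OF prems] d(1)]
        filterlim_real_sequentially[unfolded filterlim_at_top_dense, rule_format, of K]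
      by (rule eventually_conj)
    then obtain j where j: "R j < d" "K < real j"
      using eventually_happens[of _ sequentially] by auto
    define x where "x = R j *\<^sub>R e"
    have x: "norm x = R j" "x \<noteq> 0" using R(1)[of j] e by (auto simp: x_def)
    have phi_pos: "\<phi> (R j) > 0" using assms(8) R(1,2)[of j] by (auto simp: image_subset_iff)
    have a: "R j powr (- a) > 0" using R(1)[of j] by simp
    have "real (Suc j) * \<phi> (R j) \<le> B j"
      using phi[of j] by (simp add: pos_less_divide_eq mult.commute)
    then have "real (Suc j) * (\<phi> (R j) * R j powr (- a)) \<le> B j * R j powr (- a)"
      using mult_right_mono[OF _ less_imp_le[OF a]] by (simp add: mult.assoc[symmetric])
    also have "\<dots> < u x"
      using sol_centre_gt[OF prems, of j] assms(6)
      by (simp add: B_def u_def x_def D_def n_def)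
    finally have "real (Suc j) < u x / (\<phi> (norm x) * norm x powr (- a))"
      using phi_pos a x(1) by (simp add: pos_less_divide_eq)
    then have "K < u x / (\<phi> (norm x) * norm x powr (- a))" using j(2) by linarith
    then show False using d(2)[OF x(2)] x(1) j(1) by (simp add: dist_norm)
  qed
  then show ?thesis
    using smooth_on_sol[OF prems] sol_pos[OF prems] sol_inequality[OF prems]
    by (intro exI[of _ u]) (simp add: u_def)
qed

end
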